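(* Let $N, R$ be positive integers and let $F_R \colon \{-1,1\}^R \to \{-1,1\}$ be any function. Let $G^{\le N}$ be the partial function obtained from $F_R \circ \mathsf{OR}_N$ by restricting its domain to $\{-1,1\}^{N\cdot R}_{\le N}$. Then there exists a function $g \colon \{-1,1\}^{12 \cdot N \cdot \lceil \log(R+1)\rceil} \to \{-1,1\}$ such that for every $\varepsilon > 0$, $$\widetilde{\deg}_\varepsilon(g) \ge \widetilde{\deg}_\varepsilon(G^{\le N}) \cdot \lceil \log(R+1) \rceil.$$ Moreover: (i) if $F_R$ is computed by a circuit of depth $k$, then $g$ is computed by a circuit of depth $k+2$; (ii) if $F_R$ is computed by a monotone circuit of depth $k$, then $g$ is computed by a monotone circuit of depth $k+2$ with $\mathsf{AND}$ gates at the bottom; (iii) if $F_R$ is computed by a monotone DNF of width $w$, then $g$ is computed by a monotone DNF of width $O(w \cdot \log R)$.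
   Context: Boolean values: $-1$ is TRUE and $+1$ is FALSE. $\mathsf{OR}_N \colon \{-1,1\}^N \to \{-1,1\}$ outputs $-1$ iff at least one input equals $-1$. For $x \in \{-1,1\}^n$, the Hamming weight is $|x| = \sum_i (1-x_i)/2$ (the number of $-1$ entries), and $\{-1,1\}^{M}_{\le N} = \{x \in \{-1,1\}^M : |x| \le N\}$. The block composition $F_R \circ \mathsf{OR}_N \colon (\{-1,1\}^N)^R \to \{-1,1\}$ is $(x_1,\dots,x_R) \mapsto F_R(\mathsf{OR}_N(x_1),\dots,\mathsf{OR}_N(x_R))$. For a function $h$ defined on a subset $\mathcal{X} \subseteq \mathbb{R}^n$, $\widetilde{\deg}_\varepsilon(h)$ is the least degree of a real polynomial $p$ with $|p(x) - h(x)| \le \varepsilon$ for all $x \in \mathcal{X}$ (no constraint outside $\mathcal{X}$). Circuits have unbounded fan-in $\mathsf{AND}/\mathsf{OR}$ gates and $\mathsf{NOT}$ gates, polynomial size unless otherwise specified; monotone means no $\mathsf{NOT}$ gates. Logarithms are base 2. *)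

theory Defs
  imports Complex_Main "HOL-Library.FuncSet" "HOL-Library.Poly_Mapping"
begin

section \<open>The Boolean cube, with \<open>-1\<close> for TRUE and \<open>1\<close> for FALSE\<close>

definition cube :: "nat \<Rightarrow> (nat \<Rightarrow> real) set" where
  "cube n = {..<n} \<rightarrow>\<^sub>E {-1, 1}"

definition hamming_weight :: "nat \<Rightarrow> (nat \<Rightarrow> real) \<Rightarrow> real" where
  "hamming_weight n x = (\<Sum>i<n. (1 - x i) / 2)"

definition cube_le :: "nat \<Rightarrow> nat \<Rightarrow> (nat \<Rightarrow> real) set" where
  "cube_le M N = {x \<in> cube M. hamming_weight M x \<le> real N}"

definition OR_fun :: "nat \<Rightarrow> (nat \<Rightarrow> real) \<Rightarrow> real" where
  "OR_fun n x = (if \<exists>i<n. x i = -1 then -1 else 1)"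

text \<open>\<open>F\<^sub>R \<circ> OR\<^sub>N\<close>; the \<open>R\<close> blocks of length \<open>N\<close> are laid out consecutively in one vector of
  length \<open>N * R\<close>, entry \<open>j\<close> of block \<open>i\<close> at position \<open>i * N + j\<close>.\<close>

definition compose_OR ::
  "((nat \<Rightarrow> real) \<Rightarrow> real) \<Rightarrow> nat \<Rightarrow> nat \<Rightarrow> (nat \<Rightarrow> real) \<Rightarrow> real" where
  "compose_OR F R N x =
     F (restrict (\<lambda>i. OR_fun N (restrict (\<lambda>j. x (i * N + j)) {..<N})) {..<R})"


section \<open>Multivariate real polynomials and approximate degree\<close>

text \<open>A monomial maps each variable to its exponent, a polynomial each monomial to its coefficient.\<close>

type_synonym real_mpoly = "(nat \<Rightarrow>\<^sub>0 nat) \<Rightarrow>\<^sub>0 real"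

definition mpoly_eval :: "real_mpoly \<Rightarrow> (nat \<Rightarrow> real) \<Rightarrow> real" where
  "mpoly_eval p x = (\<Sum>m\<in>Poly_Mapping.keys p. Poly_Mapping.lookup p m *
     (\<Prod>i\<in>Poly_Mapping.keys m. x i ^ Poly_Mapping.lookup m i))"

definition mpoly_vars :: "real_mpoly \<Rightarrow> nat set" where
  "mpoly_vars p = (\<Union>m\<in>Poly_Mapping.keys p. Poly_Mapping.keys m)"

text \<open>Total degree; the zero polynomial gets degree \<open>0\<close>.\<close>

definition mpoly_degree :: "real_mpoly \<Rightarrow> nat" where
  "mpoly_degree p = Max (insert 0
     ((\<lambda>m. \<Sum>i\<in>Poly_Mapping.keys m. Poly_Mapping.lookup m i) ` Poly_Mapping.keys p))"

text \<open>\<open>approx_deg n X \<epsilon> h\<close> is the \<open>\<epsilon>\<close>-approximate degree of the partial function \<open>h\<close> with domain \<open>X\<close>,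
  a set of vectors of length \<open>n\<close>. Nothing is required of the polynomial outside \<open>X\<close>.\<close>

definition approx_deg ::
  "nat \<Rightarrow> (nat \<Rightarrow> real) set \<Rightarrow> real \<Rightarrow> ((nat \<Rightarrow> real) \<Rightarrow> real) \<Rightarrow> nat" where
  "approx_deg n X \<epsilon> h =
     (LEAST d. \<exists>p. mpoly_vars p \<subseteq> {..<n} \<and> mpoly_degree p = d \<and>
        (\<forall>x\<in>X. \<bar>mpoly_eval p x - h x\<bar> \<le> \<epsilon>))"


section \<open>Unbounded fan-in circuits\<close>

text \<open>A circuit is a directed acyclic graph, given as a topologically sorted list of nodes: a gate
  refers to the positions of earlier nodes, and the last node is the output. Gates of fan-in \<open>0\<close> are
  allowed and give the constants.\<close>

datatype gate =
    is_Input: Input nat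
  | is_And: And_Gate "nat set"
  | is_Or: Or_Gate "nat set"
  | is_Not: Not_Gate nat

type_synonym circuit = "gate list"

primrec gate_inputs :: "gate \<Rightarrow> nat set" where
  "gate_inputs (Input v) = {}"
| "gate_inputs (And_Gate J) = J"
| "gate_inputs (Or_Gate J) = J"
| "gate_inputs (Not_Gate j) = {j}"

definition circuit_wf :: "nat \<Rightarrow> circuit \<Rightarrow> bool" where
  "circuit_wf n c \<longleftrightarrow> c \<noteq> [] \<and> (\<forall>v. Input v \<in> set c \<longrightarrow> v < n) \<and>
     (\<forall>i<length c. gate_inputs (c ! i) \<subseteq> {..<i})"

text \<open>In the next two functions the list argument holds the values (depths) of all earlier nodes.\<close>

primrec gate_value :: "(nat \<Rightarrow> real) \<Rightarrow> real list \<Rightarrow> gate \<Rightarrow> real" where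
  "gate_value x vs (Input v) = x v"
| "gate_value x vs (And_Gate J) = (if \<forall>j\<in>J. vs ! j = -1 then -1 else 1)"
| "gate_value x vs (Or_Gate J) = (if \<exists>j\<in>J. vs ! j = -1 then -1 else 1)"
| "gate_value x vs (Not_Gate j) = - (vs ! j)"

text \<open>As usual for circuits of this kind, NOT gates do not contribute to the depth.\<close>

primrec gate_depth :: "nat list \<Rightarrow> gate \<Rightarrow> nat" where
  "gate_depth ds (Input v) = 0"
| "gate_depth ds (And_Gate J) = Suc (Max (insert 0 ((!) ds ` J)))"
| "gate_depth ds (Or_Gate J) = Suc (Max (insert 0 ((!) ds ` J)))"
| "gate_depth ds (Not_Gate j) = ds ! j"

definition circuit_value :: "circuit \<Rightarrow> (nat \<Rightarrow> real) \<Rightarrow> real" where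
  "circuit_value c x = last (foldl (\<lambda>vs g. vs @ [gate_value x vs g]) [] c)"

definition circuit_depth :: "circuit \<Rightarrow> nat" where
  "circuit_depth c = last (foldl (\<lambda>ds g. ds @ [gate_depth ds g]) [] c)"

definition circuit_size :: "circuit \<Rightarrow> nat" where
  "circuit_size c = length c"

definition circuit_computes :: "nat \<Rightarrow> circuit \<Rightarrow> ((nat \<Rightarrow> real) \<Rightarrow> real) \<Rightarrow> bool" where
  "circuit_computes n c f \<longleftrightarrow> circuit_wf n c \<and> (\<forall>x\<in>cube n. circuit_value c x = f x)"

definition monotone_circuit :: "circuit \<Rightarrow> bool" where
  "monotone_circuit c \<longleftrightarrow> (\<forall>g\<in>set c. \<not> is_Not g)"

text \<open>The bottom gates are those that read an input variable: they have to be AND gates reading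
  input variables only, and the output may not be a bare input variable.\<close>

definition AND_at_bottom :: "circuit \<Rightarrow> bool" where
  "AND_at_bottom c \<longleftrightarrow> \<not> is_Input (last c) \<and>
     (\<forall>g\<in>set c. (\<exists>j\<in>gate_inputs g. is_Input (c ! j)) \<longrightarrow>
        is_And g \<and> (\<forall>j\<in>gate_inputs g. is_Input (c ! j)))"


section \<open>Monotone DNFs\<close>

text \<open>A monotone DNF is a set of terms, a term the set of the variables occurring in it.\<close>

type_synonym mono_dnf = "nat set set"

definition dnf_value :: "mono_dnf \<Rightarrow> (nat \<Rightarrow> real) \<Rightarrow> real" where
  "dnf_value T x = (if \<exists>t\<in>T. \<forall>i\<in>t. x i = -1 then -1 else 1)"

definition dnf_width :: "mono_dnf \<Rightarrow> nat" where
  "dnf_width T = Max (insert 0 (card ` T))"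

definition dnf_computes :: "nat \<Rightarrow> mono_dnf \<Rightarrow> ((nat \<Rightarrow> real) \<Rightarrow> real) \<Rightarrow> bool" where
  "dnf_computes n T f \<longleftrightarrow> (\<forall>t\<in>T. t \<subseteq> {..<n}) \<and> (\<forall>x\<in>cube n. dnf_value T x = f x)"

end

theory Submission
  imports Defs "HOL-Combinatorics.Permutations"
begin

text \<open>
  An input \<open>x\<close> of \<open>F \<circ> OR\<^sub>N\<close> with at most \<open>N\<close> entries \<open>-1\<close> is, up to the order of the entries, a list of \<open>N\<close>
  symbols from \<open>{0..R}\<close>: symbol \<open>r + 1\<close> for each \<open>-1\<close> in block \<open>r\<close>, padded with \<open>0\<close>. A linear code with
  \<open>l\<close> generators and minimum distance \<open>l\<close> in \<open>6 l\<close> bits (Gilbert--Varshamov) yields distributions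
  \<open>\<mu>\<^sub>0, \<dots>, \<mu>\<^sub>R\<close> on words with disjoint supports that no polynomial of degree less than \<open>l\<close> can tell apart.
  The function \<open>g\<close> reads \<open>N\<close> encoded words and evaluates \<open>F\<close> on the set of symbols that occur.

  Given a polynomial \<open>p\<close> for \<open>g\<close>, replace each symbol of a randomly permuted list by a word drawn from
  its distribution and take expectations. In every monomial, a block of degree less than \<open>l\<close>
  contributes a constant, so at most \<open>deg p div l\<close> blocks matter, and the average over permutations turns
  a product over \<open>t\<close> blocks into a polynomial of degree \<open>t\<close> in \<open>x\<close>.

  Writing each bit next to its negation makes the encoding balanced. On encoded inputs, equality with
  a codeword is then the same as domination of it, so \<open>g\<close> is monotone whenever \<open>F\<close> is.
\<close>

section \<open>Polynomial functions of bounded degree\<close>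

definition monom_eval :: "(nat \<Rightarrow>\<^sub>0 nat) \<Rightarrow> (nat \<Rightarrow> real) \<Rightarrow> real" where
  "monom_eval m x = (\<Prod>i\<in>Poly_Mapping.keys m. x i ^ Poly_Mapping.lookup m i)"

definition monom_degree :: "(nat \<Rightarrow>\<^sub>0 nat) \<Rightarrow> nat" where
  "monom_degree m = (\<Sum>i\<in>Poly_Mapping.keys m. Poly_Mapping.lookup m i)"

lemma monom_eval_superset:
  assumes "finite A" "Poly_Mapping.keys m \<subseteq> A"
  shows "monom_eval m x = (\<Prod>i\<in>A. x i ^ Poly_Mapping.lookup m i)"
  unfolding monom_eval_def using assms
  by (intro prod.mono_neutral_left) (auto simp: in_keys_iff)

lemma monom_degree_superset:
  assumes "finite A" "Poly_Mapping.keys m \<subseteq> A"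
  shows "monom_degree m = (\<Sum>i\<in>A. Poly_Mapping.lookup m i)"
  unfolding monom_degree_def using assms
  by (intro sum.mono_neutral_left) (auto simp: in_keys_iff)

lemma monom_eval_add: "monom_eval (m + k) x = monom_eval m x * monom_eval k x"
proof -
  let ?A = "Poly_Mapping.keys m \<union> Poly_Mapping.keys k"
  have "monom_eval (m + k) x = (\<Prod>i\<in>?A. x i ^ Poly_Mapping.lookup (m + k) i)"
    using Poly_Mapping.keys_add[of m k] by (intro monom_eval_superset) auto
  also have "\<dots> = (\<Prod>i\<in>?A. x i ^ Poly_Mapping.lookup m i) * (\<Prod>i\<in>?A. x i ^ Poly_Mapping.lookup k i)"
    by (simp add: lookup_add power_add prod.distrib)
  also have "\<dots> = monom_eval m x * monom_eval k x"
    by (simp add: monom_eval_superset[of ?A])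
  finally show ?thesis .
qed

lemma monom_degree_add: "monom_degree (m + k) = monom_degree m + monom_degree k"
proof -
  let ?A = "Poly_Mapping.keys m \<union> Poly_Mapping.keys k"
  have "monom_degree (m + k) = (\<Sum>i\<in>?A. Poly_Mapping.lookup (m + k) i)"
    using Poly_Mapping.keys_add[of m k] by (intro monom_degree_superset) auto
  also have "\<dots> = (\<Sum>i\<in>?A. Poly_Mapping.lookup m i) + (\<Sum>i\<in>?A. Poly_Mapping.lookup k i)"
    by (simp add: lookup_add sum.distrib)
  also have "\<dots> = monom_degree m + monom_degree k"
    by (simp add: monom_degree_superset[of ?A])
  finally show ?thesis .
qed

lemma mpoly_eval_alt:
  "mpoly_eval p x = (\<Sum>m\<in>Poly_Mapping.keys p. Poly_Mapping.lookup p m * monom_eval m x)"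
  by (simp add: mpoly_eval_def monom_eval_def)

lemma mpoly_eval_superset:
  assumes "finite A" "Poly_Mapping.keys p \<subseteq> A"
  shows "mpoly_eval p x = (\<Sum>m\<in>A. Poly_Mapping.lookup p m * monom_eval m x)"
  unfolding mpoly_eval_alt using assms
  by (intro sum.mono_neutral_left) (auto simp: in_keys_iff)

lemma mpoly_eval_zero [simp]: "mpoly_eval 0 x = 0"
  by (simp add: mpoly_eval_def)

lemma mpoly_eval_add: "mpoly_eval (p + q) x = mpoly_eval p x + mpoly_eval q x"
proof -
  let ?A = "Poly_Mapping.keys p \<union> Poly_Mapping.keys q"
  have "mpoly_eval (p + q) x = (\<Sum>m\<in>?A. Poly_Mapping.lookup (p + q) m * monom_eval m x)"
    using Poly_Mapping.keys_add[of p q] by (intro mpoly_eval_superset) auto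
  also have "\<dots> = mpoly_eval p x + mpoly_eval q x"
    by (simp add: lookup_add distrib_right sum.distrib mpoly_eval_superset[of ?A])
  finally show ?thesis .
qed

lemma mpoly_eval_sum: "mpoly_eval (\<Sum>i\<in>A. p i) x = (\<Sum>i\<in>A. mpoly_eval (p i) x)"
  by (induction A rule: infinite_finite_induct) (simp_all add: mpoly_eval_add)

lemma mpoly_eval_single: "mpoly_eval (Poly_Mapping.single m c) x = c * monom_eval m x"
  by (subst mpoly_eval_superset[of "{m}"]) auto

lemma sum_single_lookup:
  fixes p :: "'a \<Rightarrow>\<^sub>0 'b::comm_monoid_add"
  shows "(\<Sum>m\<in>Poly_Mapping.keys p. Poly_Mapping.single m (Poly_Mapping.lookup p m)) = p"
  by (rule poly_mapping_eqI)
    (auto simp: lookup_sum lookup_single when_def in_keys_iff sum.delta)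

lemma mpoly_eval_mult: "mpoly_eval (p * q) x = mpoly_eval p x * mpoly_eval q x"
proof -
  have "p * q = (\<Sum>m\<in>Poly_Mapping.keys p. Poly_Mapping.single m (Poly_Mapping.lookup p m)) *
                (\<Sum>k\<in>Poly_Mapping.keys q. Poly_Mapping.single k (Poly_Mapping.lookup q k))"
    by (simp add: sum_single_lookup)
  also have "\<dots> = (\<Sum>m\<in>Poly_Mapping.keys p. \<Sum>k\<in>Poly_Mapping.keys q.
      Poly_Mapping.single (m + k) (Poly_Mapping.lookup p m * Poly_Mapping.lookup q k))"
    by (simp add: sum_product mult_single)
  finally show ?thesis
    by (simp add: mpoly_eval_sum mpoly_eval_single monom_eval_add mpoly_eval_alt[of p]
        mpoly_eval_alt[of q] sum_product algebra_simps)
qed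

lemma mpoly_degree_le_iff:
  "mpoly_degree p \<le> d \<longleftrightarrow> (\<forall>m\<in>Poly_Mapping.keys p. monom_degree m \<le> d)"
  by (simp add: mpoly_degree_def monom_degree_def)

text \<open>A property of functions on \<open>X\<close> rather than of polynomials, with an upper
  bound on the degree in place of an exact one. In this form it is closed under the algebraic
  operations, even where leading terms cancel.\<close>

definition poly_on :: "nat \<Rightarrow> nat \<Rightarrow> (nat \<Rightarrow> real) set \<Rightarrow> ((nat \<Rightarrow> real) \<Rightarrow> real) \<Rightarrow> bool" where
  "poly_on n d X f \<longleftrightarrow>
     (\<exists>p. mpoly_vars p \<subseteq> {..<n} \<and> mpoly_degree p \<le> d \<and> (\<forall>x\<in>X. mpoly_eval p x = f x))"

lemma poly_on_cong:
  assumes "\<And>x. x \<in> X \<Longrightarrow> f x = g x"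
  shows "poly_on n d X f \<longleftrightarrow> poly_on n d X g"
  using assms by (simp add: poly_on_def)

lemma poly_on_mono: "poly_on n d X f \<Longrightarrow> d \<le> e \<Longrightarrow> poly_on n e X f"
  unfolding poly_on_def by (meson le_trans)

lemma poly_on_const: "poly_on n d X (\<lambda>x. c)"
  unfolding poly_on_def
proof (intro exI conjI ballI)
  let ?p = "Poly_Mapping.single 0 c :: real_mpoly"
  show "mpoly_vars ?p \<subseteq> {..<n}" by (auto simp: mpoly_vars_def)
  show "mpoly_degree ?p \<le> d" by (auto simp: mpoly_degree_le_iff monom_degree_def split: if_splits)
  show "mpoly_eval ?p x = c" for x by (simp add: mpoly_eval_single monom_eval_def)
qed

lemma poly_on_var:
  assumes "i < n"
  shows "poly_on n 1 X (\<lambda>x. x i)"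
  unfolding poly_on_def
proof (intro exI conjI ballI)
  let ?p = "Poly_Mapping.single (Poly_Mapping.single i 1) 1 :: real_mpoly"
  show "mpoly_vars ?p \<subseteq> {..<n}" using assms by (auto simp: mpoly_vars_def)
  show "mpoly_degree ?p \<le> 1" by (auto simp: mpoly_degree_le_iff monom_degree_def)
  show "mpoly_eval ?p x = x i" for x by (simp add: mpoly_eval_single monom_eval_def)
qed

lemma poly_on_add:
  assumes "poly_on n d X f" "poly_on n d X g"
  shows "poly_on n d X (\<lambda>x. f x + g x)"
proof -
  obtain p q where p: "mpoly_vars p \<subseteq> {..<n}" "mpoly_degree p \<le> d" "\<forall>x\<in>X. mpoly_eval p x = f x"
    and q: "mpoly_vars q \<subseteq> {..<n}" "mpoly_degree q \<le> d" "\<forall>x\<in>X. mpoly_eval q x = g x"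
    using assms unfolding poly_on_def by blast
  have "mpoly_vars (p + q) \<subseteq> {..<n}"
    using p(1) q(1) Poly_Mapping.keys_add[of p q] unfolding mpoly_vars_def by fast
  moreover have "mpoly_degree (p + q) \<le> d"
    using p(2) q(2) Poly_Mapping.keys_add[of p q] unfolding mpoly_degree_le_iff by blast
  ultimately show ?thesis
    unfolding poly_on_def using p(3) q(3) by (intro exI[of _ "p + q"]) (simp add: mpoly_eval_add)
qed

lemma poly_on_mult:
  assumes "poly_on n d X f" "poly_on n e X g"
  shows "poly_on n (d + e) X (\<lambda>x. f x * g x)"
proof -
  obtain p q where p: "mpoly_vars p \<subseteq> {..<n}" "mpoly_degree p \<le> d" "\<forall>x\<in>X. mpoly_eval p x = f x"
    and q: "mpoly_vars q \<subseteq> {..<n}" "mpoly_degree q \<le> e" "\<forall>x\<in>X. mpoly_eval q x = g x"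
    using assms unfolding poly_on_def by blast
  have keys: "\<exists>a\<in>Poly_Mapping.keys p. \<exists>b\<in>Poly_Mapping.keys q. m = a + b"
    if "m \<in> Poly_Mapping.keys (p * q)" for m
    using that Poly_Mapping.keys_mult[of p q] by blast
  have "mpoly_vars (p * q) \<subseteq> {..<n}"
  proof
    fix i assume "i \<in> mpoly_vars (p * q)"
    then obtain a b where ab: "a \<in> Poly_Mapping.keys p" "b \<in> Poly_Mapping.keys q"
      "i \<in> Poly_Mapping.keys (a + b)"
      unfolding mpoly_vars_def using keys by blast
    then have "i \<in> Poly_Mapping.keys a \<union> Poly_Mapping.keys b"
      using Poly_Mapping.keys_add[of a b] by blast
    with ab p(1) q(1) show "i \<in> {..<n}" unfolding mpoly_vars_def by blast
  qed
  moreover have "mpoly_degree (p * q) \<le> d + e"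
    using p(2) q(2) keys unfolding mpoly_degree_le_iff
    by (metis add_mono monom_degree_add)
  ultimately show ?thesis
    unfolding poly_on_def using p(3) q(3) by (intro exI[of _ "p * q"]) (simp add: mpoly_eval_mult)
qed

lemma poly_on_cmult: "poly_on n d X f \<Longrightarrow> poly_on n d X (\<lambda>x. c * f x)"
  using poly_on_mult[OF poly_on_const[of n 0 X c]] by simp

lemma poly_on_sum:
  assumes "\<And>i. i \<in> A \<Longrightarrow> poly_on n d X (f i)"
  shows "poly_on n d X (\<lambda>x. \<Sum>i\<in>A. f i x)"
  using assms
  by (induction A rule: infinite_finite_induct) (simp_all add: poly_on_const poly_on_add)

lemma poly_on_prod:
  assumes "finite A" "\<And>i. i \<in> A \<Longrightarrow> poly_on n 1 X (f i)"
  shows "poly_on n (card A) X (\<lambda>x. \<Prod>i\<in>A. f i x)"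
  using assms
proof (induction A rule: finite_induct)
  case (insert i A)
  then have "poly_on n (1 + card A) X (\<lambda>x. f i x * (\<Prod>i\<in>A. f i x))"
    by (intro poly_on_mult) auto
  then show ?case using insert by simp
qed (simp add: poly_on_const)

section \<open>Interpolation and approximate degree on the cube\<close>

lemma finite_cube [simp]: "finite (cube n)"
  by (simp add: cube_def finite_PiE)

lemma cubeD: "x \<in> cube n \<Longrightarrow> i < n \<Longrightarrow> x i = -1 \<or> x i = 1"
  unfolding cube_def by (metis PiE_mem insertE lessThan_iff singletonD)

text \<open>Multilinear interpolation shows that the \<open>LEAST\<close> in \<^const>\<open>approx_deg\<close> ranges over a nonempty set.\<close>

lemma poly_on_cube: "poly_on n n (cube n) f"
proof -
  \<comment> \<open>On the cube each factor is 1 or 0 according as \<open>a i\<close> and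
    \<open>x i\<close> agree, so the product is the indicator of the point \<open>a\<close>.\<close>
  have delta: "(\<Prod>i<n. (1 + a i * x i) / 2) = (if a = x then 1 else 0)"
    if "a \<in> cube n" "x \<in> cube n" for a x
  proof (cases "a = x")
    case True
    then have "(1 + a i * x i) / 2 = 1" if "i < n" for i
      using cubeD[OF \<open>x \<in> cube n\<close> that] by auto
    with True show ?thesis by simp
  next
    case False
    have "a = x" if "\<And>i. i < n \<Longrightarrow> a i = x i"
      using \<open>a \<in> cube n\<close> \<open>x \<in> cube n\<close> that unfolding cube_def by (intro PiE_ext) auto
    with False obtain i where i: "i < n" "a i \<noteq> x i" by blast
    then have "(1 + a i * x i) / 2 = 0"
      using cubeD[OF that(1) i(1)] cubeD[OF that(2) i(1)] by auto
    then have "(\<Prod>i<n. (1 + a i * x i) / 2) = 0"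
      using i(1) by (meson finite_lessThan lessThan_iff prod_zero)
    with False show ?thesis by simp
  qed
  have eq: "f x = (\<Sum>a\<in>cube n. f a * (\<Prod>i<n. (1 / 2 + (a i / 2) * x i)))" if "x \<in> cube n" for x
  proof -
    have "(\<Sum>a\<in>cube n. f a * (\<Prod>i<n. (1 / 2 + (a i / 2) * x i))) =
          (\<Sum>a\<in>cube n. f a * (\<Prod>i<n. (1 + a i * x i) / 2))"
      by (simp add: add_divide_distrib)
    also have "\<dots> = (\<Sum>a\<in>cube n. if a = x then f a else 0)"
      using that delta by (intro sum.cong) auto
    also have "\<dots> = f x" using that by simp
    finally show ?thesis by simp
  qed
  have "poly_on n (card {..<n}) (cube n) (\<lambda>x. \<Prod>i<n. (1 / 2 + (a i / 2) * x i))" for a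
    by (intro poly_on_prod poly_on_add poly_on_const poly_on_cmult poly_on_var) auto
  then have "poly_on n n (cube n) (\<lambda>x. \<Sum>a\<in>cube n. f a * (\<Prod>i<n. (1 / 2 + (a i / 2) * x i)))"
    by (intro poly_on_sum poly_on_cmult) simp
  then show ?thesis using eq by (simp cong: poly_on_cong)
qed

lemma approx_deg_le:
  assumes "poly_on n d X q" "\<And>x. x \<in> X \<Longrightarrow> \<bar>q x - h x\<bar> \<le> \<epsilon>"
  shows "approx_deg n X \<epsilon> h \<le> d"
proof -
  obtain p where p: "mpoly_vars p \<subseteq> {..<n}" "mpoly_degree p \<le> d" "\<forall>x\<in>X. mpoly_eval p x = q x"
    using assms(1) unfolding poly_on_def by blast
  have "approx_deg n X \<epsilon> h \<le> mpoly_degree p"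
    unfolding approx_deg_def by (rule Least_le) (use p assms(2) in auto)
  with p(2) show ?thesis by simp
qed

text \<open>Exact interpolation has error 0, so for \<open>\<epsilon> \<ge> 0\<close> some degree is
  admissible and the minimum is attained.\<close>

lemma approx_deg_cube_witness:
  assumes "\<epsilon> \<ge> 0"
  obtains p where "mpoly_vars p \<subseteq> {..<n}" "mpoly_degree p = approx_deg n (cube n) \<epsilon> h"
    "\<And>x. x \<in> cube n \<Longrightarrow> \<bar>mpoly_eval p x - h x\<bar> \<le> \<epsilon>"
proof -
  let ?P = "\<lambda>d. \<exists>p. mpoly_vars p \<subseteq> {..<n} \<and> mpoly_degree p = d \<and>
    (\<forall>x\<in>cube n. \<bar>mpoly_eval p x - h x\<bar> \<le> \<epsilon>)"
  obtain p where "mpoly_vars p \<subseteq> {..<n}" "\<forall>x\<in>cube n. mpoly_eval p x = h x"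
    using poly_on_cube[of n h] unfolding poly_on_def by blast
  with assms have "?P (mpoly_degree p)" by auto
  then have "?P (LEAST d. ?P d)" by (rule LeastI)
  with that show ?thesis unfolding approx_deg_def by blast
qed

section \<open>Binary codes and locally indistinguishable distributions\<close>

text \<open>The Walsh character with frequency set \<open>S\<close>, a word being given as the set
  of its 1-bits.\<close>

definition chi :: "nat set \<Rightarrow> nat set \<Rightarrow> real" where
  "chi S b = (-1) ^ card (S \<inter> b)"

lemma chi_empty [simp]: "chi {} b = 1"
  by (simp add: chi_def)

lemma chi_abs: "chi S b = 1 \<or> chi S b = -1"
  unfolding chi_def by (metis neg_one_even_power neg_one_odd_power)

text \<open>Elements of \<open>S \<inter> T \<inter> b\<close> are counted once by each factor on
  the right, so their signs cancel; the remaining ones are those of the symmetric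
  difference.\<close>

lemma chi_sym_diff:
  assumes "finite S" "finite T"
  shows "chi (sym_diff S T) b = chi S b * chi T b"
proof -
  let ?c = "card (S \<inter> T \<inter> b)"
  have S: "card (S \<inter> b) = card ((S - T) \<inter> b) + ?c"
    using assms by (subst card_Un_disjoint[symmetric]) (auto intro!: arg_cong[where f = card])
  have T: "card (T \<inter> b) = card ((T - S) \<inter> b) + ?c"
    using assms by (subst card_Un_disjoint[symmetric]) (auto intro!: arg_cong[where f = card])
  have U: "card (sym_diff S T \<inter> b) = card ((S - T) \<inter> b) + card ((T - S) \<inter> b)"
    using assms by (subst card_Un_disjoint[symmetric]) (auto intro!: arg_cong[where f = card])
  have sq: "(-1 :: real) ^ ?c * (-1) ^ ?c = 1"
    by (simp flip: power_mult_distrib)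
  have "chi S b * chi T b =
    (-1) ^ card ((S - T) \<inter> b) * (-1) ^ card ((T - S) \<inter> b) * ((-1) ^ ?c * (-1) ^ ?c)"
    unfolding chi_def S T power_add by (simp only: mult_ac)
  then show ?thesis unfolding sq by (simp add: chi_def U power_add)
qed

text \<open>Toggling a fixed \<open>j \<in> S\<close> is an involution on the words that changes the
  sign of \<open>chi S\<close>.\<close>

lemma sum_chi_Pow:
  assumes "S \<subseteq> {..<m}" "S \<noteq> {}"
  shows "(\<Sum>b\<in>Pow {..<m}. chi S b) = 0"
proof -
  obtain j where j: "j \<in> S" using assms by blast
  have fin: "finite S" using assms(1) finite_subset by blast
  have flip: "chi S (sym_diff b {j}) = - chi S b" if "finite b" for b
  proof -
    \<comment> \<open>\<open>chi\<close> is symmetric in its arguments, so multiplicativity in the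
      frequency also gives multiplicativity in the word.\<close>
    have "chi S (sym_diff b {j}) = chi (sym_diff b {j}) S"
      by (simp add: chi_def Int_commute)
    also have "\<dots> = chi b S * chi {j} S" using that by (intro chi_sym_diff) auto
    also have "chi {j} S = -1" using j by (simp add: chi_def)
    finally show ?thesis by (simp add: chi_def Int_commute)
  qed
  have "(\<Sum>b\<in>Pow {..<m}. chi S b) = (\<Sum>b\<in>Pow {..<m}. chi S (sym_diff b {j}))"
    by (rule sum.reindex_bij_witness[where i = "\<lambda>b. sym_diff b {j}" and j = "\<lambda>b. sym_diff b {j}"])
      (use j assms(1) in \<open>auto intro!: arg_cong[where f = "chi S"]\<close>)
  also have "\<dots> = (\<Sum>b\<in>Pow {..<m}. - chi S b)"
    by (intro sum.cong refl flip) (auto intro: finite_subset)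
  finally show ?thesis by (simp add: sum_negf)
qed

section \<open>Hamming balls and the Gilbert-Varshamov code\<close>

lemma card_small_subsets:
  "finite {e. e \<subseteq> {..<m} \<and> card e < l}"
  "card {e. e \<subseteq> {..<m} \<and> card e < l} = (\<Sum>i<l. m choose i)"
proof -
  have eq: "{e. e \<subseteq> {..<m} \<and> card e < l} = (\<Union>i<l. {e. e \<subseteq> {..<m} \<and> card e = i})"
    by auto
  show "finite {e. e \<subseteq> {..<m} \<and> card e < l}" by simp
  show "card {e. e \<subseteq> {..<m} \<and> card e < l} = (\<Sum>i<l. m choose i)"
    unfolding eq by (subst card_UN_disjoint) (auto simp: n_subsets)
qed

text \<open>The binomial theorem for \<open>(1 + 1/2)^(6l)\<close> gives the bound \<open>(2 (3/2)^6)^l\<close>,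
  and \<open>2 (3/2)^6 < 32\<close>.\<close>

lemma binomial_volume_bound: "(\<Sum>i<l. (6 * l) choose i) \<le> 32 ^ l"
proof -
  let ?m = "6 * l"
  have "real (\<Sum>i<l. ?m choose i) = (\<Sum>i<l. real (?m choose i))" by simp
  \<comment> \<open>For \<open>i < l\<close> the inserted factor \<open>2 ^ l * (1 / 2) ^ i\<close>
    is at least 1; it prepares the binomial theorem.\<close>
  also have "\<dots> \<le> (\<Sum>i<l. 2 ^ l * (real (?m choose i) * (1 / 2) ^ i))"
  proof (intro sum_mono)
    fix i assume "i \<in> {..<l}"
    then have "(1::real) \<le> 2 ^ (l - i)" by simp
    also have "\<dots> = 2 ^ l * (1 / 2) ^ i"
      using \<open>i \<in> {..<l}\<close> by (simp add: power_diff power_divide)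
    finally show "real (?m choose i) \<le> 2 ^ l * (real (?m choose i) * (1 / 2) ^ i)"
      using mult_left_mono[of 1 "2 ^ l * (1 / 2) ^ i" "real (?m choose i)"]
      by (simp add: mult_ac)
  qed
  also have "\<dots> = 2 ^ l * (\<Sum>i<l. real (?m choose i) * (1 / 2) ^ i)"
    by (simp add: sum_distrib_left)
  also have "\<dots> \<le> 2 ^ l * (\<Sum>i\<le>?m. real (?m choose i) * (1 / 2) ^ i)"
    by (intro mult_left_mono sum_mono2) auto
  also have "(\<Sum>i\<le>?m. real (?m choose i) * (1 / 2) ^ i) = (1 / 2 + 1) ^ ?m"
    unfolding binomial_ring by simp
  also have "2 ^ l * (1 / 2 + 1 :: real) ^ ?m = (2 * (3 / 2) ^ 6) ^ l"
    by (simp add: power_mult power_mult_distrib)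
  also have "\<dots> \<le> 32 ^ l" by (intro power_mono) (simp_all add: power_divide)
  finally have "real (\<Sum>i<l. ?m choose i) \<le> real (32 ^ l)" by simp
  then show ?thesis by (simp only: of_nat_le_iff)
qed

text \<open>Gilbert--Varshamov: the rows \<open>v\<close> are picked greedily, and \<open>f I\<close> is the sum of the rows in \<open>I\<close>.\<close>

lemma greedy_code:
  assumes "k \<le> l"
  shows "\<exists>(v::nat \<Rightarrow> nat set) f. \<forall>I\<subseteq>{..<k}. f I \<subseteq> {..<6 * l} \<and> (I \<noteq> {} \<longrightarrow> l \<le> card (f I)) \<and>
    (\<forall>b. chi (f I) b = (\<Prod>i\<in>I. chi (v i) b))"
  using assms
proof (induction k)
  case 0
  show ?case by (intro exI[of _ "\<lambda>_. {}"]) simp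
next
  case (Suc k)
  let ?m = "6 * l"
  obtain v f where vf: "\<And>I. I \<subseteq> {..<k} \<Longrightarrow> f I \<subseteq> {..<?m}"
    "\<And>I. I \<subseteq> {..<k} \<Longrightarrow> I \<noteq> {} \<Longrightarrow> l \<le> card (f I)"
    "\<And>I b. I \<subseteq> {..<k} \<Longrightarrow> chi (f I) b = (\<Prod>i\<in>I. chi (v i) b)"
    using Suc by (metis Suc_leD)
  let ?E = "{e. e \<subseteq> {..<?m} \<and> card e < l}"
  \<comment> \<open>\<open>?bad\<close> is the union of the balls of radius less than
    \<open>l\<close> around the code words so far. A row \<open>u\<close> outside it has distance at
    least \<open>l\<close> from all of them, which bounds the weight of every new word.\<close>
  let ?bad = "(\<lambda>(I, e). sym_diff (f I) e) ` (Pow {..<k} \<times> ?E)"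
  have "card ?bad \<le> card (Pow {..<k} \<times> ?E)"
    by (intro card_image_le) (simp add: card_small_subsets)
  also have "\<dots> = 2 ^ k * (\<Sum>i<l. ?m choose i)"
    by (simp add: card_cartesian_product card_Pow card_small_subsets)
  also have "\<dots> \<le> 2 ^ k * 32 ^ l" using binomial_volume_bound by simp
  \<comment> \<open>\<open>k < l\<close> gives strictness, and \<open>2 * 32 = 2 ^ 6\<close> is the
    reason for words of \<open>6 * l\<close> bits.\<close>
  also have "\<dots> < 2 ^ l * 32 ^ l" using Suc.prems by simp
  also have "\<dots> = (2 ^ 6) ^ l" unfolding power_mult_distrib[symmetric] by simp
  also have "\<dots> = card (Pow {..<?m})" unfolding power_mult[symmetric] by (simp add: card_Pow)
  finally have less: "card ?bad < card (Pow {..<?m})" .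
  have "finite ?bad" by (simp add: card_small_subsets)
  then have "card (Pow {..<?m}) \<le> card ?bad" if "Pow {..<?m} \<subseteq> ?bad"
    using that by (rule card_mono)
  with less have "\<not> Pow {..<?m} \<subseteq> ?bad" by linarith
  then obtain u where u: "u \<subseteq> {..<?m}" "u \<notin> ?bad" by blast
  have far: "l \<le> card (sym_diff (f I) u)" if "I \<subseteq> {..<k}" for I
  proof (rule ccontr)
    assume close: "\<not> l \<le> card (sym_diff (f I) u)"
    define e where "e = sym_diff (f I) u"
    have "e \<in> ?E"
      using close vf(1)[OF that] u(1) unfolding e_def by auto
    then have "(\<lambda>(I, e). sym_diff (f I) e) (I, e) \<in> ?bad"
      using that by (intro imageI) simp
    moreover have "sym_diff (f I) e = u" unfolding e_def by blast
    ultimately show False using u(2) by simp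
  qed
  let ?v = "v(k := u)"
  let ?f = "\<lambda>I. if k \<in> I then sym_diff (f (I - {k})) u else f I"
  have "?f I \<subseteq> {..<?m} \<and> (I \<noteq> {} \<longrightarrow> l \<le> card (?f I)) \<and>
    (\<forall>b. chi (?f I) b = (\<Prod>i\<in>I. chi (?v i) b))" if I: "I \<subseteq> {..<Suc k}" for I
  proof (cases "k \<in> I")
    case True
    then have sub: "I - {k} \<subseteq> {..<k}" using I by force
    have fin: "finite (f (I - {k}))" "finite u" "finite I"
      using vf(1)[OF sub] u(1) I finite_subset by blast+
    have "chi (?f I) b = (\<Prod>i\<in>I. chi (?v i) b)" for b
    proof -
      have "chi (?f I) b = (\<Prod>i\<in>I - {k}. chi (v i) b) * chi u b"
        using True chi_sym_diff[OF fin(1,2), of b] vf(3)[OF sub, of b] by simp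
      also have "(\<Prod>i\<in>I - {k}. chi (v i) b) = (\<Prod>i\<in>I - {k}. chi (?v i) b)"
        by (intro prod.cong) auto
      also have "\<dots> * chi u b = (\<Prod>i\<in>I. chi (?v i) b)"
        using True fin by (simp add: prod.remove[of I k])
      finally show ?thesis .
    qed
    with True far[OF sub] vf(1)[OF sub] u(1) show ?thesis by auto
  next
    case False
    then have sub: "I \<subseteq> {..<k}" using I by (auto simp: less_Suc_eq)
    have "(\<Prod>i\<in>I. chi (?v i) b) = (\<Prod>i\<in>I. chi (v i) b)" for b
      using False by (intro prod.cong) auto
    with False vf[OF sub] show ?thesis by auto
  qed
  then show ?case by (intro exI[of _ ?v] exI[of _ ?f] allI impI)
qed

text \<open>\<open>\<mu> r\<close> is uniform on the words whose inner products with the rows of the code spell out \<open>r\<close>.\<close>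

lemma indistinguishable_distributions:
  fixes K l :: nat
  assumes "K \<le> 2 ^ l" "0 < l"
  shows "\<exists>\<mu> :: nat \<Rightarrow> nat set \<Rightarrow> real. (\<forall>r b. \<mu> r b \<ge> 0) \<and>
    (\<forall>r. (\<Sum>b\<in>Pow {..<6 * l}. \<mu> r b) = 1) \<and>
    (\<forall>r<K. \<forall>r'<K. \<forall>b. \<mu> r b \<noteq> 0 \<longrightarrow> \<mu> r' b \<noteq> 0 \<longrightarrow> r = r') \<and>
    (\<forall>r r' S. S \<subseteq> {..<6 * l} \<longrightarrow> card S < l \<longrightarrow>
       (\<Sum>b\<in>Pow {..<6 * l}. \<mu> r b * chi S b) = (\<Sum>b\<in>Pow {..<6 * l}. \<mu> r' b * chi S b))"
proof -
  let ?m = "6 * l"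
  obtain v f where vf: "\<And>I. I \<subseteq> {..<l} \<Longrightarrow> f I \<subseteq> {..<?m}"
    "\<And>I. I \<subseteq> {..<l} \<Longrightarrow> I \<noteq> {} \<Longrightarrow> l \<le> card (f I)"
    "\<And>I b. I \<subseteq> {..<l} \<Longrightarrow> chi (f I) b = (\<Prod>i\<in>I. chi (v i) b)"
    using greedy_code[of l l] by (metis order_refl)
  have "card {..<K} \<le> card (Pow {..<l})" using assms by (simp add: card_Pow)
  \<comment> \<open>\<open>\<sigma> r\<close> is a binary name with \<open>l\<close> bits for the
    symbol \<open>r\<close>; \<open>K \<le> 2 ^ l\<close> leaves enough names.\<close>
  then obtain \<sigma> :: "nat \<Rightarrow> nat set" where \<sigma>: "inj_on \<sigma> {..<K}" "\<sigma> ` {..<K} \<subseteq> Pow {..<l}"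
    using card_le_inj[of "{..<K}" "Pow {..<l}"] by auto
  define sg where "sg r i = (if i \<in> \<sigma> r then -1 else 1 :: real)" for r i
  \<comment> \<open>Each factor is 0 or 2, so the product is a multiple of the indicator of
    \<open>chi (v i) b = sg r i\<close> for all \<open>i < l\<close>. Written as a product it
    expands into characters of code words.\<close>
  define \<mu> where "\<mu> r b = (\<Prod>i<l. 1 + sg r i * chi (v i) b) / 2 ^ ?m" for r b
  have nonneg: "\<mu> r b \<ge> 0" for r b
  proof -
    have "1 + sg r i * chi (v i) b \<ge> 0" for i
      using chi_abs[of "v i" b] by (auto simp: sg_def)
    then show ?thesis unfolding \<mu>_def by (intro divide_nonneg_pos prod_nonneg) auto
  qed
  have expand: "\<mu> r b = (\<Sum>I\<in>Pow {..<l}. (\<Prod>i\<in>I. sg r i) * chi (f I) b) / 2 ^ ?m" for r b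
  proof -
    have "(\<Prod>i<l. sg r i * chi (v i) b + 1) = (\<Sum>I\<in>Pow {..<l}. (\<Prod>i\<in>I. sg r i * chi (v i) b) * (\<Prod>i\<in>{..<l} - I. 1))"
      by (rule prod_add) simp
    also have "\<dots> = (\<Sum>I\<in>Pow {..<l}. (\<Prod>i\<in>I. sg r i) * chi (f I) b)"
      by (intro sum.cong) (auto simp: vf(3) prod.distrib)
    finally show ?thesis by (simp add: \<mu>_def add.commute)
  qed
  \<comment> \<open>The right-hand side does not depend on \<open>r\<close>. By the minimum
    distance, \<open>f I\<close> for nonempty \<open>I\<close> differs from every \<open>S\<close>
    with fewer than \<open>l\<close> elements, so orthogonality removes all terms of the expansion
    but \<open>I = {}\<close>.\<close>
  have moment: "(\<Sum>b\<in>Pow {..<?m}. \<mu> r b * chi S b) = (\<Sum>b\<in>Pow {..<?m}. chi S b) / 2 ^ ?m"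
    if S: "S \<subseteq> {..<?m}" "card S < l" for r S
  proof -
    have finS: "finite S" using S(1) finite_subset by blast
    have zero: "(\<Sum>b\<in>Pow {..<?m}. chi (f I) b * chi S b) = 0" if I: "I \<subseteq> {..<l}" "I \<noteq> {}" for I
    proof -
      have fin: "finite (f I)" using vf(1)[OF I(1)] finite_subset by blast
      have "f I \<noteq> S" using vf(2)[OF I] S(2) by auto
      then have "(\<Sum>b\<in>Pow {..<?m}. chi (sym_diff (f I) S) b) = 0"
        using vf(1)[OF I(1)] S(1) by (intro sum_chi_Pow) auto
      then show ?thesis by (simp add: chi_sym_diff[OF fin finS])
    qed
    have scaled: "2 ^ ?m * \<mu> r b = (\<Sum>I\<in>Pow {..<l}. (\<Prod>i\<in>I. sg r i) * chi (f I) b)" for b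
      unfolding expand by simp
    have "2 ^ ?m * (\<Sum>b\<in>Pow {..<?m}. \<mu> r b * chi S b) =
      (\<Sum>b\<in>Pow {..<?m}. (2 ^ ?m * \<mu> r b) * chi S b)"
      by (simp add: sum_distrib_left mult_ac)
    also have "\<dots> =
      (\<Sum>b\<in>Pow {..<?m}. \<Sum>I\<in>Pow {..<l}. (\<Prod>i\<in>I. sg r i) * (chi (f I) b * chi S b))"
      unfolding scaled by (simp add: sum_distrib_left mult_ac)
    also have "\<dots> = (\<Sum>I\<in>Pow {..<l}. (\<Prod>i\<in>I. sg r i) * (\<Sum>b\<in>Pow {..<?m}. chi (f I) b * chi S b))"
      by (subst sum.swap) (simp add: sum_distrib_left)
    also have "\<dots> = (\<Sum>I\<in>{{}}. (\<Prod>i\<in>I. sg r i) * (\<Sum>b\<in>Pow {..<?m}. chi (f I) b * chi S b))"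
      using zero by (intro sum.mono_neutral_right) auto
    also have "\<dots> = (\<Sum>b\<in>Pow {..<?m}. chi S b)"
      using vf(3)[of "{}"] by simp
    finally show ?thesis by (simp add: field_simps)
  qed
  \<comment> \<open>The case \<open>S = {}\<close> of the moments, available because
    \<open>0 < l\<close>.\<close>
  have total: "(\<Sum>b\<in>Pow {..<?m}. \<mu> r b) = 1" for r
    using moment[of "{}" r] assms by (simp add: card_Pow)
  have disj: "r = r'" if r: "r < K" "r' < K" "\<mu> r b \<noteq> 0" "\<mu> r' b \<noteq> 0" for r r' b
  proof -
    have sg_eq: "sg r i = chi (v i) b" if "i < l" "\<mu> r b \<noteq> 0" for r i
    proof -
      have "1 + sg r i * chi (v i) b \<noteq> 0" using that by (auto simp: \<mu>_def)
      then show ?thesis using chi_abs[of "v i" b] by (auto simp: sg_def split: if_splits)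
    qed
    have "i \<in> \<sigma> r \<longleftrightarrow> i \<in> \<sigma> r'" if "i < l" for i
      using sg_eq[OF that r(3)] sg_eq[OF that r(4)] by (auto simp: sg_def split: if_splits)
    moreover have "\<sigma> r \<subseteq> {..<l}" "\<sigma> r' \<subseteq> {..<l}" using \<sigma>(2) r by blast+
    ultimately have "\<sigma> r = \<sigma> r'" by blast
    with \<sigma>(1) r show ?thesis by (simp add: inj_on_eq_iff)
  qed
  show ?thesis
    by (intro exI[of _ \<mu>] conjI allI impI) (use nonneg total disj moment in auto)
qed

section \<open>Symmetrization\<close>

text \<open>Each factor \<open>\<phi> t (s x (\<pi> t))\<close> may be averaged over all positions \<open>j \<notin> T\<close>; the sum over all
  positions is linear in \<open>x\<close>, and the positions in \<open>T\<close> merge with existing factors.\<close>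

lemma poly_on_symmetrization:
  fixes s :: "(nat \<Rightarrow> real) \<Rightarrow> nat \<Rightarrow> nat" and \<phi> :: "nat \<Rightarrow> nat \<Rightarrow> real"
  assumes lin: "\<And>\<psi>. poly_on n 1 X (\<lambda>x. \<Sum>j<N. \<psi> (s x j))"
    and "T \<subseteq> {..<N}"
  shows "poly_on n (card T) X (\<lambda>x. \<Sum>\<pi> | \<pi> permutes {..<N}. \<Prod>i\<in>T. \<phi> i (s x (\<pi> i)))"
proof -
  have "finite T" using assms(2) finite_subset by blast
  then show ?thesis using assms(2)
  proof (induction T arbitrary: \<phi> rule: finite_induct)
    case empty
    show ?case by (simp add: poly_on_const)
  next
    case (insert t T)
    let ?P = "{\<pi>. \<pi> permutes {..<N}}"
    define A where "A \<pi> x = (\<Prod>i\<in>T. \<phi> i (s x (\<pi> i)))" for \<pi> x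
    \<comment> \<open>\<open>\<phi>' j\<close> absorbs the factor of \<open>t\<close> into the
      factor at \<open>j\<close>, so a collision of positions gives a product over \<open>T\<close>
      again. The induction therefore has to range over all \<open>\<phi>\<close>.\<close>
    define \<phi>' where "\<phi>' j i = (\<lambda>r. \<phi> i r * (if i = j then \<phi> t r else 1))" for j i
    have T: "T \<subseteq> {..<N}" "t < N" "t \<notin> T" using insert by auto
    define c where "c = card ({..<N} - T)"
    have "c > 0" unfolding c_def using T by (simp add: card_gt_0_iff) blast
    \<comment> \<open>Composition with the transposition of \<open>t\<close> and \<open>j\<close>
      permutes the set of permutations and leaves the factors over \<open>T\<close> alone, as
      neither point lies in \<open>T\<close>.\<close>
    have swap: "(\<Sum>\<pi>\<in>?P. A \<pi> x * \<phi> t (s x (\<pi> j))) = (\<Sum>\<pi>\<in>?P. A \<pi> x * \<phi> t (s x (\<pi> t)))"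
      if j: "j \<in> {..<N} - T" for j x
    proof -
      let ?q = "transpose t j"
      have q: "?q permutes {..<N}" using j T by (intro permutes_swap_id) auto
      have "(\<Sum>\<pi>\<in>?P. A \<pi> x * \<phi> t (s x (\<pi> j))) =
            (\<Sum>\<pi>\<in>?P. A (\<pi> \<circ> ?q) x * \<phi> t (s x ((\<pi> \<circ> ?q) j)))"
        by (rule sum_permutations_compose_right[OF q])
      also have "\<dots> = (\<Sum>\<pi>\<in>?P. A \<pi> x * \<phi> t (s x (\<pi> t)))"
      proof (intro sum.cong refl)
        fix \<pi>
        have "A (\<pi> \<circ> ?q) x = A \<pi> x"
          unfolding A_def by (intro prod.cong refl) (use j T in \<open>auto simp: transpose_def\<close>)
        then show "A (\<pi> \<circ> ?q) x * \<phi> t (s x ((\<pi> \<circ> ?q) j)) = A \<pi> x * \<phi> t (s x (\<pi> t))"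
          by simp
      qed
      finally show ?thesis .
    qed
    \<comment> \<open>The sum over all positions does not depend on \<open>\<pi>\<close> and is
      affine in \<open>x\<close> by \<open>lin\<close>. Only the collisions with \<open>T\<close>
      have to be subtracted.\<close>
    have step: "A \<pi> x * (\<Sum>j\<in>{..<N} - T. \<phi> t (s x (\<pi> j))) =
        (\<Sum>j<N. \<phi> t (s x j)) * A \<pi> x + (- 1) * (\<Sum>j\<in>T. \<Prod>i\<in>T. \<phi>' j i (s x (\<pi> i)))"
      if \<pi>: "\<pi> permutes {..<N}" for \<pi> x
    proof -
      have "(\<Sum>j\<in>{..<N} - T. \<phi> t (s x (\<pi> j))) =
          (\<Sum>j<N. \<phi> t (s x (\<pi> j))) - (\<Sum>j\<in>T. \<phi> t (s x (\<pi> j)))"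
        using T by (intro sum_diff) auto
      also have "(\<Sum>j<N. \<phi> t (s x (\<pi> j))) = (\<Sum>j<N. \<phi> t (s x j))"
        using sum.permute[OF \<pi>, of "\<lambda>j. \<phi> t (s x j)"] by (simp add: comp_def)
      finally have 1: "A \<pi> x * (\<Sum>j\<in>{..<N} - T. \<phi> t (s x (\<pi> j))) =
        (\<Sum>j<N. \<phi> t (s x j)) * A \<pi> x - (\<Sum>j\<in>T. A \<pi> x * \<phi> t (s x (\<pi> j)))"
        by (simp add: right_diff_distrib sum_distrib_left mult.commute)
      have "A \<pi> x * \<phi> t (s x (\<pi> j)) = (\<Prod>i\<in>T. \<phi>' j i (s x (\<pi> i)))" if "j \<in> T" for j
      proof -
        have "(\<Prod>i\<in>T. if i = j then \<phi> t (s x (\<pi> i)) else 1) = \<phi> t (s x (\<pi> j))"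
          using that insert.hyps(1) by (subst prod.delta) auto
        then show ?thesis by (simp add: \<phi>'_def A_def prod.distrib)
      qed
      then have "(\<Sum>j\<in>T. A \<pi> x * \<phi> t (s x (\<pi> j))) = (\<Sum>j\<in>T. \<Prod>i\<in>T. \<phi>' j i (s x (\<pi> i)))"
        by (intro sum.cong) auto
      with 1 show ?thesis by simp
    qed
    \<comment> \<open>Averaging over the \<open>c\<close> positions outside \<open>T\<close>: the
      first product raises the degree by one, the collision terms do not.\<close>
    have main: "(\<Sum>\<pi>\<in>?P. \<Prod>i\<in>insert t T. \<phi> i (s x (\<pi> i))) =
      (1 / real c) * ((\<Sum>j<N. \<phi> t (s x j)) * (\<Sum>\<pi>\<in>?P. \<Prod>i\<in>T. \<phi> i (s x (\<pi> i))) +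
        (- 1) * (\<Sum>j\<in>T. \<Sum>\<pi>\<in>?P. \<Prod>i\<in>T. \<phi>' j i (s x (\<pi> i))))" for x
    proof -
      have "real c * (\<Sum>\<pi>\<in>?P. \<Prod>i\<in>insert t T. \<phi> i (s x (\<pi> i))) =
        (\<Sum>j\<in>{..<N} - T. \<Sum>\<pi>\<in>?P. A \<pi> x * \<phi> t (s x (\<pi> t)))"
        using T insert.hyps by (simp add: c_def A_def mult.commute)
      also have "\<dots> = (\<Sum>j\<in>{..<N} - T. \<Sum>\<pi>\<in>?P. A \<pi> x * \<phi> t (s x (\<pi> j)))"
        by (rule sum.cong[OF refl]) (rule swap[symmetric])
      also have "\<dots> = (\<Sum>\<pi>\<in>?P. A \<pi> x * (\<Sum>j\<in>{..<N} - T. \<phi> t (s x (\<pi> j))))"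
        by (subst sum.swap) (simp add: sum_distrib_left)
      also have "\<dots> = (\<Sum>\<pi>\<in>?P. (\<Sum>j<N. \<phi> t (s x j)) * A \<pi> x +
          (- 1) * (\<Sum>j\<in>T. \<Prod>i\<in>T. \<phi>' j i (s x (\<pi> i))))"
        using step by (intro sum.cong) auto
      also have "\<dots> = (\<Sum>j<N. \<phi> t (s x j)) * (\<Sum>\<pi>\<in>?P. A \<pi> x) +
          (- 1) * (\<Sum>\<pi>\<in>?P. \<Sum>j\<in>T. \<Prod>i\<in>T. \<phi>' j i (s x (\<pi> i)))"
        unfolding sum.distrib sum_distrib_left ..
      also have "(\<Sum>\<pi>\<in>?P. \<Sum>j\<in>T. \<Prod>i\<in>T. \<phi>' j i (s x (\<pi> i))) =
          (\<Sum>j\<in>T. \<Sum>\<pi>\<in>?P. \<Prod>i\<in>T. \<phi>' j i (s x (\<pi> i)))"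
        by (rule sum.swap)
      finally show ?thesis using \<open>c > 0\<close> by (simp add: field_simps A_def)
    qed
    have "poly_on n (1 + card T) X (\<lambda>x. (\<Sum>j<N. \<phi> t (s x j)) *
        (\<Sum>\<pi>\<in>?P. \<Prod>i\<in>T. \<phi> i (s x (\<pi> i))))"
      using T by (intro poly_on_mult lin insert.IH)
    moreover have "poly_on n (1 + card T) X (\<lambda>x. (- 1) *
        (\<Sum>j\<in>T. \<Sum>\<pi>\<in>?P. \<Prod>i\<in>T. \<phi>' j i (s x (\<pi> i))))"
      using T by (intro poly_on_cmult poly_on_sum poly_on_mono[OF insert.IH]) auto
    ultimately have "poly_on n (1 + card T) X
        (\<lambda>x. \<Sum>\<pi>\<in>?P. \<Prod>i\<in>insert t T. \<phi> i (s x (\<pi> i)))"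
      unfolding main by (rule poly_on_cmult[OF poly_on_add])
    then show ?case using insert.hyps by simp
  qed
qed

text \<open>A word \<open>b \<subseteq> {..<6 l}\<close> is written with \<open>12 l\<close> bits, bit \<open>j\<close> of \<open>b\<close> at position \<open>2 j\<close> and its
  negation at position \<open>2 j + 1\<close>. All encodings have the same weight, so none dominates another.\<close>

definition encode :: "nat \<Rightarrow> nat set \<Rightarrow> nat set" where
  "encode l b = {v \<in> {..<12 * l}. (v div 2 \<in> b) = even v}"

definition encode_bit :: "nat set \<Rightarrow> nat \<Rightarrow> real" where
  "encode_bit b v = (if (v div 2 \<in> b) = even v then -1 else 1)"

definition encode_vector :: "nat \<Rightarrow> nat \<Rightarrow> (nat \<Rightarrow> nat set) \<Rightarrow> nat \<Rightarrow> real" where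
  "encode_vector N l \<beta> = restrict (\<lambda>u. encode_bit (\<beta> (u div (12 * l))) (u mod (12 * l))) {..<12 * N * l}"

lemma encode_vector_cube: "encode_vector N l \<beta> \<in> cube (12 * N * l)"
  by (auto simp: encode_vector_def cube_def encode_bit_def)

lemma block_index_less: "i < N \<Longrightarrow> v < 12 * l \<Longrightarrow> i * (12 * l) + v < 12 * N * (l :: nat)"
proof -
  assume "i < N" "v < 12 * l"
  then have "i * (12 * l) + v < Suc i * (12 * l)" by simp
  also have "\<dots> \<le> N * (12 * l)" using \<open>i < N\<close> by (intro mult_le_mono1) simp
  finally show ?thesis by (simp add: mult_ac)
qed

lemma encode_vector_block:
  assumes "i < N" "v < 12 * l"
  shows "encode_vector N l \<beta> (i * (12 * l) + v) = encode_bit (\<beta> i) v"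
  using block_index_less[OF assms] assms by (simp add: encode_vector_def)

text \<open>For every \<open>j < 6 * l\<close>, exactly one of the positions \<open>2 * j\<close>
  and \<open>2 * j + 1\<close> belongs to \<open>encode l b\<close>, and the entry -1 there decides
  whether \<open>j\<close> is in the word. A test for equality thus becomes an AND without
  negations.\<close>

lemma encode_vector_dominates:
  assumes "i < N" "b \<subseteq> {..<6 * l}" "\<beta> i \<subseteq> {..<6 * l}"
  shows "(\<forall>v\<in>encode l b. encode_vector N l \<beta> (i * (12 * l) + v) = -1) \<longleftrightarrow> \<beta> i = b"
proof
  assume dom: "\<forall>v\<in>encode l b. encode_vector N l \<beta> (i * (12 * l) + v) = -1"
  have bit: "(v div 2 \<in> \<beta> i) = even v" if "v < 12 * l" "(v div 2 \<in> b) = even v" for v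
  proof -
    have "encode_bit (\<beta> i) v = -1"
      using dom that encode_vector_block[OF assms(1) that(1)] by (auto simp: encode_def)
    then show ?thesis by (auto simp: encode_bit_def split: if_splits)
  qed
  have "j \<in> \<beta> i \<longleftrightarrow> j \<in> b" if "j < 6 * l" for j
    using bit[of "2 * j"] bit[of "2 * j + 1"] that by auto
  then show "\<beta> i = b" using assms(2,3) by blast
next
  assume "\<beta> i = b"
  then show "\<forall>v\<in>encode l b. encode_vector N l \<beta> (i * (12 * l) + v) = -1"
    using encode_vector_block[OF assms(1)] by (auto simp: encode_def encode_bit_def)
qed

lemma card_encode_le: "card (encode l b) \<le> 12 * l"
  unfolding encode_def by (metis (no_types, lifting) Collect_subset card_lessThan card_mono
      finite_lessThan mem_Collect_eq subsetI)

section \<open>Moments of a single encoded block\<close>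

lemma encode_bit_chi: "encode_bit b v = (if even v then 1 else -1) * chi {v div 2} b"
  by (auto simp: encode_bit_def chi_def)

text \<open>Entries are 1 or -1, so only odd exponents count, and both positions of a bit carry the
  same character up to sign. A monomial therefore collapses to a multiple of one character of no
  larger degree.\<close>

lemma encode_bit_monomial:
  assumes "finite V"
  shows "\<exists>\<kappa> S. S \<subseteq> (\<lambda>v. v div 2) ` V \<and> card S \<le> (\<Sum>v\<in>V. a v) \<and>
    (\<forall>b. (\<Prod>v\<in>V. encode_bit b v ^ a v) = \<kappa> * chi S b)"
  using assms
proof (induction V rule: finite_induct)
  case empty
  show ?case by (intro exI[of _ 1] exI[of _ "{}"]) simp
next
  case (insert v V)
  then obtain \<kappa> S where S: "S \<subseteq> (\<lambda>v. v div 2) ` V" "card S \<le> (\<Sum>v\<in>V. a v)"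
    "\<And>b. (\<Prod>v\<in>V. encode_bit b v ^ a v) = \<kappa> * chi S b" by blast
  have finS: "finite S" using S(1) insert.hyps(1) finite_surj by blast
  show ?case
  proof (cases "even (a v)")
    case True
    then have "encode_bit b v ^ a v = 1" for b
      by (auto simp: encode_bit_def)
    then show ?thesis using S insert.hyps
      by (intro exI[of _ \<kappa>] exI[of _ S]) auto
  next
    case False
    \<comment> \<open>The symmetric difference, as the other position of the same bit may have put
      \<open>v div 2\<close> into \<open>S\<close> already.\<close>
    let ?S = "sym_diff {v div 2} S"
    have "encode_bit b v ^ a v = encode_bit b v" for b
      using False by (auto simp: encode_bit_def)
    then have "(\<Prod>v\<in>insert v V. encode_bit b v ^ a v) = ((if even v then 1 else -1) * \<kappa>) * chi ?S b" for b
      using insert.hyps S(3)[of b] chi_sym_diff[OF _ finS, of "{v div 2}" b]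
      by (simp add: encode_bit_chi)
    moreover have "card ?S \<le> (\<Sum>v\<in>insert v V. a v)"
    proof -
      have "card ?S \<le> card ({v div 2} \<union> S)" using finS by (intro card_mono) auto
      also have "\<dots> \<le> 1 + card S" using card_Un_le[of "{v div 2}" S] by simp
      also have "\<dots> \<le> a v + (\<Sum>v\<in>V. a v)" using False S(2) by (intro add_mono) (auto elim: oddE)
      finally show ?thesis using insert.hyps by simp
    qed
    moreover have "?S \<subseteq> (\<lambda>v. v div 2) ` insert v V" using S(1) by blast
    ultimately show ?thesis by blast
  qed
qed

lemma block_moment_eq:
  fixes \<mu> :: "nat \<Rightarrow> nat set \<Rightarrow> real"
  assumes moment: "\<And>r r' S. S \<subseteq> {..<6 * l} \<Longrightarrow> card S < l \<Longrightarrow>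
       (\<Sum>b\<in>Pow {..<6 * l}. \<mu> r b * chi S b) = (\<Sum>b\<in>Pow {..<6 * l}. \<mu> r' b * chi S b)"
    and "(\<Sum>v<12 * l. a v) < l"
  shows "(\<Sum>b\<in>Pow {..<6 * l}. \<mu> r b * (\<Prod>v<12 * l. encode_bit b v ^ a v)) =
         (\<Sum>b\<in>Pow {..<6 * l}. \<mu> r' b * (\<Prod>v<12 * l. encode_bit b v ^ a v))"
proof -
  obtain \<kappa> S where S: "S \<subseteq> (\<lambda>v. v div 2) ` {..<12 * l}" "card S \<le> (\<Sum>v<12 * l. a v)"
    "\<And>b. (\<Prod>v<12 * l. encode_bit b v ^ a v) = \<kappa> * chi S b"
    using encode_bit_monomial[of "{..<12 * l}" a] by auto
  have "S \<subseteq> {..<6 * l}" using S(1) by auto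
  moreover have "card S < l" using S(2) assms(2) by simp
  ultimately have "(\<Sum>b\<in>Pow {..<6 * l}. \<mu> r b * chi S b) = (\<Sum>b\<in>Pow {..<6 * l}. \<mu> r' b * chi S b)"
    by (rule moment)
  then have "\<kappa> * (\<Sum>b\<in>Pow {..<6 * l}. \<mu> r b * chi S b) = \<kappa> * (\<Sum>b\<in>Pow {..<6 * l}. \<mu> r' b * chi S b)"
    by simp
  then show ?thesis unfolding S(3) sum_distrib_left by (simp add: mult_ac)
qed

section \<open>Blocks of coordinates and the reduction of the degree\<close>

lemma prod_blocks:
  fixes f :: "nat \<Rightarrow> 'a :: comm_monoid_mult"
  shows "(\<Prod>u<N * M. f u) = (\<Prod>i<N. \<Prod>v<M. f (i * M + v))"
proof -
  have "(\<Prod>v<M. f (i * M + v)) = prod f {i * M..<i * M + M}" for i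
    by (rule prod.reindex_bij_witness[where i = "\<lambda>u. u - i * M" and j = "\<lambda>v. i * M + v"]) auto
  then show ?thesis by (simp add: prod.nat_group)
qed

lemma sum_blocks:
  fixes f :: "nat \<Rightarrow> 'a :: comm_monoid_add"
  shows "(\<Sum>u<N * M. f u) = (\<Sum>i<N. \<Sum>v<M. f (i * M + v))"
proof -
  have "(\<Sum>v<M. f (i * M + v)) = sum f {i * M..<i * M + M}" for i
    by (rule sum.reindex_bij_witness[where i = "\<lambda>u. u - i * M" and j = "\<lambda>v. i * M + v"]) auto
  then show ?thesis by (simp add: sum.nat_group)
qed

text \<open>Averaging a polynomial of degree \<open>d\<close> for \<open>g\<close> gives one of
  degree at most \<open>d div l\<close> for \<open>h\<close>. Here \<open>s x\<close> is the list of
  symbols of \<open>x\<close>; \<open>lin\<close> makes symmetrization available, and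
  \<open>agree\<close> ensures that all encodings of positive weight have the right value, whatever
  the order of the symbols.\<close>

theorem approx_deg_block_encoding:
  fixes \<mu> :: "nat \<Rightarrow> nat set \<Rightarrow> real" and s :: "(nat \<Rightarrow> real) \<Rightarrow> nat \<Rightarrow> nat"
  assumes "0 < l"
    and nonneg: "\<And>r b. \<mu> r b \<ge> 0"
    and total: "\<And>r. (\<Sum>b\<in>Pow {..<6 * l}. \<mu> r b) = 1"
    and moment: "\<And>r r' S. S \<subseteq> {..<6 * l} \<Longrightarrow> card S < l \<Longrightarrow>
       (\<Sum>b\<in>Pow {..<6 * l}. \<mu> r b * chi S b) = (\<Sum>b\<in>Pow {..<6 * l}. \<mu> r' b * chi S b)"
    and lin: "\<And>\<psi>. poly_on n 1 X (\<lambda>x. \<Sum>j<N. \<psi> (s x j))"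
    and agree: "\<And>x \<pi> \<beta>. x \<in> X \<Longrightarrow> \<pi> permutes {..<N} \<Longrightarrow> (\<And>i. i < N \<Longrightarrow> \<beta> i \<subseteq> {..<6 * l}) \<Longrightarrow>
       (\<And>i. i < N \<Longrightarrow> \<mu> (s x (\<pi> i)) (\<beta> i) \<noteq> 0) \<Longrightarrow> g (encode_vector N l \<beta>) = h x"
    and "\<epsilon> \<ge> 0"
  shows "approx_deg n X \<epsilon> h * l \<le> approx_deg (12 * N * l) (cube (12 * N * l)) \<epsilon> g"
proof -
  let ?B = "PiE {..<N} (\<lambda>_. Pow {..<6 * l})" and ?P = "{\<pi>. \<pi> permutes {..<N}}"
  let ?M = "12 * l"
  let ?y = "encode_vector N l"
  obtain p where p: "mpoly_vars p \<subseteq> {..<12 * N * l}"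
    "mpoly_degree p = approx_deg (12 * N * l) (cube (12 * N * l)) \<epsilon> g"
    "\<And>x. x \<in> cube (12 * N * l) \<Longrightarrow> \<bar>mpoly_eval p x - g x\<bar> \<le> \<epsilon>"
    using approx_deg_cube_witness[OF \<open>\<epsilon> \<ge> 0\<close>] by metis
  define d where "d = mpoly_degree p"
  \<comment> \<open>The probability of the pair: a uniform permutation, then independent words for
    the permuted symbols.\<close>
  define w where "w x \<pi> \<beta> = (\<Prod>i<N. \<mu> (s x (\<pi> i)) (\<beta> i)) / fact N" for x \<pi> \<beta>
  define q where "q x = (\<Sum>\<pi>\<in>?P. \<Sum>\<beta>\<in>?B. w x \<pi> \<beta> * mpoly_eval p (?y \<beta>))" for x
  define E where "E a r = (\<Sum>b\<in>Pow {..<6 * l}. \<mu> r b * (\<Prod>v<?M. encode_bit b v ^ a v))"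
    for a :: "nat \<Rightarrow> nat" and r
  define e where "e m i v = Poly_Mapping.lookup m (i * ?M + v)" for m :: "nat \<Rightarrow>\<^sub>0 nat" and i v
  \<comment> \<open>\<open>T m\<close> collects the blocks in which \<open>m\<close> has degree at
    least \<open>l\<close>; only these can distinguish symbols.\<close>
  define T where "T m = {i \<in> {..<N}. l \<le> (\<Sum>v<?M. e m i v)}" for m
  have keys: "Poly_Mapping.keys m \<subseteq> {..<N * ?M}" "monom_degree m \<le> d"
    if "m \<in> Poly_Mapping.keys p" for m
    using that p(1) mpoly_degree_le_iff[of p d] by (auto simp: mpoly_vars_def d_def mult_ac)
  have cardT: "card (T m) \<le> d div l" if m: "m \<in> Poly_Mapping.keys p" for m
  proof -
    have "card (T m) * l = (\<Sum>i\<in>T m. l)" by simp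
    also have "\<dots> \<le> (\<Sum>i\<in>T m. \<Sum>v<?M. e m i v)" by (intro sum_mono) (simp add: T_def)
    also have "\<dots> \<le> (\<Sum>i<N. \<Sum>v<?M. e m i v)" by (intro sum_mono2) (auto simp: T_def)
    also have "\<dots> = monom_degree m"
      unfolding e_def by (simp add: monom_degree_superset[OF _ keys(1)[OF m]] flip: sum_blocks)
    also have "\<dots> \<le> d" by (rule keys(2)[OF m])
    finally show ?thesis using \<open>0 < l\<close> by (simp add: less_eq_div_iff_mult_less_eq)
  qed
  \<comment> \<open>Given the permutation, the words are independent, so the expectation of a
    monomial is a product over the blocks.\<close>
  have monom: "(\<Sum>\<beta>\<in>?B. w x \<pi> \<beta> * monom_eval m (?y \<beta>)) = (\<Prod>i<N. E (e m i) (s x (\<pi> i))) / fact N"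
    if m: "m \<in> Poly_Mapping.keys p" for m x \<pi>
  proof -
    have "monom_eval m (?y \<beta>) = (\<Prod>i<N. \<Prod>v<?M. encode_bit (\<beta> i) v ^ e m i v)" for \<beta>
    proof -
      have "monom_eval m (?y \<beta>) = (\<Prod>u<N * ?M. ?y \<beta> u ^ Poly_Mapping.lookup m u)"
        by (rule monom_eval_superset) (use keys(1)[OF m] in auto)
      also have "\<dots> = (\<Prod>i<N. \<Prod>v<?M. encode_bit (\<beta> i) v ^ e m i v)"
        unfolding prod_blocks[of _ N ?M] e_def by (intro prod.cong refl) (simp add: encode_vector_block)
      finally show ?thesis .
    qed
    then have "(\<Sum>\<beta>\<in>?B. w x \<pi> \<beta> * monom_eval m (?y \<beta>)) =
       (\<Sum>\<beta>\<in>?B. \<Prod>i<N. \<mu> (s x (\<pi> i)) (\<beta> i) * (\<Prod>v<?M. encode_bit (\<beta> i) v ^ e m i v)) / fact N"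
      by (simp add: w_def prod.distrib sum_divide_distrib)
    also have "\<dots> = (\<Prod>i<N. E (e m i) (s x (\<pi> i))) / fact N"
      unfolding E_def by (subst prod_sum_PiE) auto
    finally show ?thesis .
  qed
  \<comment> \<open>Outside \<open>T m\<close> the moment is the same for all symbols, so symbol 0
    can stand for any of them.\<close>
  have split: "(\<Prod>i<N. E (e m i) (\<sigma> i)) = (\<Prod>i\<in>{..<N} - T m. E (e m i) 0) * (\<Prod>i\<in>T m. E (e m i) (\<sigma> i))"
    for m and \<sigma> :: "nat \<Rightarrow> nat"
  proof -
    have "(\<Prod>i<N. E (e m i) (\<sigma> i)) = (\<Prod>i\<in>{..<N} - T m. E (e m i) (\<sigma> i)) * (\<Prod>i\<in>T m. E (e m i) (\<sigma> i))"
      by (rule prod.subset_diff) (auto simp: T_def)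
    also have "(\<Prod>i\<in>{..<N} - T m. E (e m i) (\<sigma> i)) = (\<Prod>i\<in>{..<N} - T m. E (e m i) 0)"
      unfolding E_def by (intro prod.cong refl block_moment_eq moment) (auto simp: T_def)
    finally show ?thesis .
  qed
  have q_eq: "q x = (\<Sum>m\<in>Poly_Mapping.keys p.
      (Poly_Mapping.lookup p m * (\<Prod>i\<in>{..<N} - T m. E (e m i) 0) / fact N) *
      (\<Sum>\<pi>\<in>?P. \<Prod>i\<in>T m. E (e m i) (s x (\<pi> i))))" for x
  proof -
    have "q x = (\<Sum>\<pi>\<in>?P. \<Sum>\<beta>\<in>?B. \<Sum>m\<in>Poly_Mapping.keys p.
        Poly_Mapping.lookup p m * (w x \<pi> \<beta> * monom_eval m (?y \<beta>)))"
      unfolding q_def mpoly_eval_alt sum_distrib_left by (simp add: mult_ac)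
    also have "\<dots> = (\<Sum>\<pi>\<in>?P. \<Sum>m\<in>Poly_Mapping.keys p.
        Poly_Mapping.lookup p m * (\<Sum>\<beta>\<in>?B. w x \<pi> \<beta> * monom_eval m (?y \<beta>)))"
      unfolding sum_distrib_left by (intro sum.cong refl sum.swap)
    also have "\<dots> = (\<Sum>m\<in>Poly_Mapping.keys p. \<Sum>\<pi>\<in>?P.
        Poly_Mapping.lookup p m * (\<Sum>\<beta>\<in>?B. w x \<pi> \<beta> * monom_eval m (?y \<beta>)))"
      by (rule sum.swap)
    also have "\<dots> = (\<Sum>m\<in>Poly_Mapping.keys p.
      (Poly_Mapping.lookup p m * (\<Prod>i\<in>{..<N} - T m. E (e m i) 0) / fact N) *
      (\<Sum>\<pi>\<in>?P. \<Prod>i\<in>T m. E (e m i) (s x (\<pi> i))))"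
      unfolding sum_distrib_left
    proof (intro sum.cong refl)
      fix m \<pi> assume "m \<in> Poly_Mapping.keys p"
      show "(\<Sum>\<beta>\<in>?B. Poly_Mapping.lookup p m * (w x \<pi> \<beta> * monom_eval m (?y \<beta>))) =
        Poly_Mapping.lookup p m * (\<Prod>i\<in>{..<N} - T m. E (e m i) 0) / fact N *
        (\<Prod>i\<in>T m. E (e m i) (s x (\<pi> i)))"
        unfolding sum_distrib_left[symmetric] monom[OF \<open>m \<in> _\<close>] split by simp
    qed
    finally show ?thesis .
  qed
  have "poly_on n (d div l) X (\<lambda>x. \<Sum>\<pi>\<in>?P. \<Prod>i\<in>T m. E (e m i) (s x (\<pi> i)))"
    if "m \<in> Poly_Mapping.keys p" for m
    using cardT[OF that] by (intro poly_on_mono[OF poly_on_symmetrization[OF lin]]) (auto simp: T_def)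
  then have q_poly: "poly_on n (d div l) X q"
    unfolding q_eq[abs_def] by (rule poly_on_sum[OF poly_on_cmult])
  have w_nonneg: "w x \<pi> \<beta> \<ge> 0" for x \<pi> \<beta>
    unfolding w_def by (intro divide_nonneg_pos prod_nonneg) (auto simp: nonneg)
  have w_total: "(\<Sum>\<pi>\<in>?P. \<Sum>\<beta>\<in>?B. w x \<pi> \<beta>) = 1" for x
  proof -
    have "(\<Sum>\<beta>\<in>?B. w x \<pi> \<beta>) = 1 / fact N" for \<pi>
    proof -
      have "(\<Sum>\<beta>\<in>?B. w x \<pi> \<beta>) = (\<Prod>i<N. \<Sum>b\<in>Pow {..<6 * l}. \<mu> (s x (\<pi> i)) b) / fact N"
        unfolding w_def sum_divide_distrib[symmetric] by (subst prod_sum_PiE) auto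
      then show ?thesis by (simp add: total)
    qed
    then show ?thesis by (simp add: card_permutations[of "{..<N}" N])
  qed
  have approx: "\<bar>q x - h x\<bar> \<le> \<epsilon>" if x: "x \<in> X" for x
  proof -
    \<comment> \<open>\<open>agree\<close> covers only the support of the weights; elsewhere both
      sides are 0.\<close>
    have pointwise: "\<bar>w x \<pi> \<beta> * (mpoly_eval p (?y \<beta>) - h x)\<bar> \<le> w x \<pi> \<beta> * \<epsilon>"
      if "\<pi> \<in> ?P" "\<beta> \<in> ?B" for \<pi> \<beta>
    proof (cases "w x \<pi> \<beta> = 0")
      case False
      then have "\<mu> (s x (\<pi> i)) (\<beta> i) \<noteq> 0" if "i < N" for i
        using that unfolding w_def by auto
      moreover have "\<beta> i \<subseteq> {..<6 * l}" if "i < N" for i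
        using \<open>\<beta> \<in> ?B\<close> that by (auto dest: PiE_mem)
      ultimately have "g (?y \<beta>) = h x" using x that by (intro agree) auto
      then have "\<bar>mpoly_eval p (?y \<beta>) - h x\<bar> \<le> \<epsilon>"
        using p(3)[OF encode_vector_cube, of \<beta>] by simp
      then show ?thesis using w_nonneg by (simp add: abs_mult mult_left_mono)
    qed simp
    have "q x - h x = q x - (\<Sum>\<pi>\<in>?P. \<Sum>\<beta>\<in>?B. w x \<pi> \<beta>) * h x"
      unfolding w_total by simp
    also have "\<dots> = (\<Sum>\<pi>\<in>?P. \<Sum>\<beta>\<in>?B. w x \<pi> \<beta> * (mpoly_eval p (?y \<beta>) - h x))"
      unfolding q_def by (simp add: sum_distrib_right right_diff_distrib sum_subtractf)
    finally have "\<bar>q x - h x\<bar> \<le> (\<Sum>\<pi>\<in>?P. \<Sum>\<beta>\<in>?B. w x \<pi> \<beta> * \<epsilon>)"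
      using pointwise by (auto intro!: order_trans[OF sum_abs] sum_mono)
    also have "\<dots> = (\<Sum>\<pi>\<in>?P. \<Sum>\<beta>\<in>?B. w x \<pi> \<beta>) * \<epsilon>"
      by (simp add: sum_distrib_right)
    finally show ?thesis by (simp add: w_total)
  qed
  have "approx_deg n X \<epsilon> h * l \<le> (d div l) * l"
    using approx_deg_le[OF q_poly approx] by simp
  also have "\<dots> \<le> d" by simp
  finally show ?thesis using p(2) by (simp add: d_def)
qed

text \<open>The symbol \<open>r + 1\<close> occurs as often in \<open>s x\<close> as \<open>-1\<close> occurs in block \<open>r\<close> of \<open>x\<close>,
  and \<open>0\<close> is padding.\<close>

lemma symbols_of_input:
  "\<exists>s :: (nat \<Rightarrow> real) \<Rightarrow> nat \<Rightarrow> nat.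
    (\<forall>\<psi>. poly_on (N * R) 1 (cube_le (N * R) N) (\<lambda>x. \<Sum>j<N. \<psi> (s x j))) \<and>
    (\<forall>x j. s x j \<le> R) \<and>
    (\<forall>x\<in>cube_le (N * R) N. \<forall>r<R.
       (\<exists>j<N. s x j = Suc r) \<longleftrightarrow> (\<exists>j<N. x (r * N + j) = -1))"
proof -
  define P where "P x = {v \<in> {..<N * R}. x v = -1}" for x :: "nat \<Rightarrow> real"
  have fin: "finite (P x)" for x by (simp add: P_def)
  have "\<exists>h. bij_betw h {..<card (P x)} (P x)" for x
    using ex_bij_betw_nat_finite[OF fin[of x]] by (simp add: atLeast0LessThan)
  \<comment> \<open>Any enumeration of the positions of -1 will do, as only sums over all
    \<open>j < N\<close> and the set of occurring symbols matter.\<close>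
  then obtain h where h: "\<And>x. bij_betw (h x) {..<card (P x)} (P x)" by metis
  define s where "s x j = (if j < card (P x) then Suc (h x j div N) else 0)" for x j
  have ind: "(1 - x v) / 2 = (if v \<in> P x then 1 else 0)" if "x \<in> cube (N * R)" "v < N * R" for x v
    using cubeD[OF that] that(2) by (auto simp: P_def)
  have sum_P: "(\<Sum>v\<in>P x. f v) = (\<Sum>v<N * R. (1 - x v) / 2 * f v)"
    if "x \<in> cube (N * R)" for x and f :: "nat \<Rightarrow> real"
  proof -
    have "(\<Sum>v<N * R. (1 - x v) / 2 * f v) = (\<Sum>v<N * R. if v \<in> P x then f v else 0)"
      by (intro sum.cong refl) (simp add: ind[OF that])
    also have "\<dots> = (\<Sum>v\<in>P x. f v)"
      by (intro sum.mono_neutral_cong_right) (auto simp: P_def)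
    finally show ?thesis by simp
  qed
  \<comment> \<open>The weight bound is what lets all entries -1 fit into the \<open>N\<close>
    places of the list.\<close>
  have cardP: "card (P x) \<le> N" if "x \<in> cube_le (N * R) N" for x
  proof -
    have "real (card (P x)) = hamming_weight (N * R) x"
      using sum_P[of x "\<lambda>_. 1"] that by (simp add: hamming_weight_def cube_le_def)
    with that show ?thesis by (simp add: cube_le_def)
  qed
  \<comment> \<open>Starting from a list of padding only, each -1 at position \<open>v\<close>
    exchanges one \<open>\<psi> 0\<close> for \<open>\<psi> (Suc (v div N))\<close>; the indicator
    of -1 is affine in \<open>x v\<close>.\<close>
  have sum_s: "(\<Sum>j<N. \<psi> (s x j)) =
      real N * \<psi> 0 + (\<Sum>v<N * R. (\<psi> (Suc (v div N)) - \<psi> 0) * (1 / 2 + (- 1 / 2) * x v))"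
    if x: "x \<in> cube_le (N * R) N" for x and \<psi> :: "nat \<Rightarrow> real"
  proof -
    have xc: "x \<in> cube (N * R)" using x by (simp add: cube_le_def)
    let ?c = "card (P x)"
    have "(\<Sum>j<N. \<psi> (s x j)) = (\<Sum>j<N. \<psi> 0 + (if j < ?c then \<psi> (Suc (h x j div N)) - \<psi> 0 else 0))"
      by (intro sum.cong refl) (simp add: s_def)
    also have "\<dots> = real N * \<psi> 0 + (\<Sum>j<N. if j < ?c then \<psi> (Suc (h x j div N)) - \<psi> 0 else 0)"
      by (simp add: sum.distrib)
    also have "(\<Sum>j<N. if j < ?c then \<psi> (Suc (h x j div N)) - \<psi> 0 else 0) =
        (\<Sum>j<?c. \<psi> (Suc (h x j div N)) - \<psi> 0)"
      using cardP[OF x] by (intro sum.mono_neutral_cong_right) auto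
    also have "\<dots> = (\<Sum>v\<in>P x. \<psi> (Suc (v div N)) - \<psi> 0)"
      by (rule sum.reindex_bij_betw[OF h])
    also have "\<dots> = (\<Sum>v<N * R. (\<psi> (Suc (v div N)) - \<psi> 0) * (1 / 2 + (- 1 / 2) * x v))"
      unfolding sum_P[OF xc] by (intro sum.cong refl) (simp add: field_simps)
    finally show ?thesis .
  qed
  have 1: "poly_on (N * R) 1 (cube_le (N * R) N) (\<lambda>x. \<Sum>j<N. \<psi> (s x j))" for \<psi>
  proof -
    have "poly_on (N * R) 1 (cube_le (N * R) N) (\<lambda>x.
      real N * \<psi> 0 + (\<Sum>v<N * R. (\<psi> (Suc (v div N)) - \<psi> 0) * (1 / 2 + (- 1 / 2) * x v)))"
      by (intro poly_on_add poly_on_const poly_on_sum poly_on_cmult poly_on_var) simp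
    then show ?thesis using sum_s by (simp cong: poly_on_cong)
  qed
  have hP: "h x j \<in> P x" if "j < card (P x)" for x j
    using h[of x] that by (auto simp: bij_betw_def)
  have 2: "s x j \<le> R" for x j
  proof (cases "j < card (P x)")
    case True
    have "h x j < N * R" using hP[OF True] by (simp add: P_def)
    then show ?thesis using True by (simp add: s_def less_mult_imp_div_less mult.commute Suc_le_eq)
  qed (simp add: s_def)
  have 3: "(\<exists>j<N. s x j = Suc r) \<longleftrightarrow> (\<exists>j<N. x (r * N + j) = -1)"
    if x: "x \<in> cube_le (N * R) N" and r: "r < R" for x r
  proof
    assume "\<exists>j<N. s x j = Suc r"
    then obtain j where j: "j < N" "j < card (P x)" "h x j div N = r"
      by (auto simp: s_def split: if_splits)
    from hP[OF j(2)] have "x (h x j) = -1" by (simp add: P_def)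
    moreover have "h x j = r * N + h x j mod N" using j(3) by (metis div_mult_mod_eq)
    ultimately show "\<exists>j<N. x (r * N + j) = -1"
      using j(1) by (metis gr_implies_not0 mod_less_divisor neq0_conv)
  next
    assume "\<exists>j<N. x (r * N + j) = -1"
    then obtain j where j: "j < N" "x (r * N + j) = -1" by blast
    have "r * N + j < Suc r * N" using j by simp
    also have "\<dots> \<le> R * N" using r by (intro mult_le_mono1) simp
    finally have "r * N + j \<in> P x" using j by (simp add: P_def mult.commute)
    then obtain k where k: "k < card (P x)" "h x k = r * N + j"
      using h[of x] by (metis bij_betw_iff_bijections lessThan_iff)
    then have "s x k = Suc r" using j by (simp add: s_def)
    moreover have "k < N" using k cardP[OF x] by simp
    ultimately show "\<exists>j<N. s x j = Suc r" by blast
  qed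
  show ?thesis using 1 2 3 by blast
qed

section \<open>Substituting depth-two formulas into circuits and DNFs\<close>

text \<open>An input node of the old circuit turns into an OR gate at the same place, so that all
  references between old nodes are merely shifted by the length \<open>k\<close> of the
  prefix.\<close>

primrec shift_gate :: "nat \<Rightarrow> nat \<Rightarrow> (nat \<Rightarrow> nat set) \<Rightarrow> gate \<Rightarrow> gate" where
  "shift_gate n k sel (Input r) = Or_Gate ((+) n ` sel r)"
| "shift_gate n k sel (And_Gate J) = And_Gate ((+) k ` J)"
| "shift_gate n k sel (Or_Gate J) = Or_Gate ((+) k ` J)"
| "shift_gate n k sel (Not_Gate j) = Not_Gate (k + j)"

text \<open>The AND gates are shared by all variables, so the size grows by a summand only.\<close>

definition subst_circuit :: "nat \<Rightarrow> nat set list \<Rightarrow> (nat \<Rightarrow> nat set) \<Rightarrow> circuit \<Rightarrow> circuit" where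
  "subst_circuit n As sel c =
     map Input [0..<n] @ map And_Gate As @ map (shift_gate n (n + length As) sel) c"

text \<open>Well-formedness without nonemptiness, so that it passes to prefixes in inductions over
  the gate list.\<close>

definition topo_sorted :: "nat \<Rightarrow> circuit \<Rightarrow> bool" where
  "topo_sorted R c \<longleftrightarrow> (\<forall>v. Input v \<in> set c \<longrightarrow> v < R) \<and> (\<forall>i<length c. gate_inputs (c ! i) \<subseteq> {..<i})"

lemma circuit_wf_alt: "circuit_wf R c \<longleftrightarrow> c \<noteq> [] \<and> topo_sorted R c"
  by (simp add: circuit_wf_def topo_sorted_def)

lemma topo_sorted_snoc:
  "topo_sorted R (c @ [g]) \<longleftrightarrow>
     topo_sorted R c \<and> gate_inputs g \<subseteq> {..<length c} \<and> (\<forall>v. g = Input v \<longrightarrow> v < R)"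
  by (auto simp: topo_sorted_def nth_append less_Suc_eq)

lemma length_foldl_snoc [simp]:
  "length (foldl (\<lambda>vs g. vs @ [f vs g]) us c) = length us + length c"
  by (induction c arbitrary: us) auto

section \<open>Values in the substituted circuit\<close>

lemma gate_values_inputs:
  "foldl (\<lambda>vs g. vs @ [gate_value y vs g]) [] (map Input [0..<n]) = map y [0..<n]"
  by (induction n) auto

lemma gate_values_ands:
  assumes "\<And>A. A \<in> set As \<Longrightarrow> A \<subseteq> {..<n}"
  shows "foldl (\<lambda>vs g. vs @ [gate_value y vs g]) (map y [0..<n]) (map And_Gate As) =
    map y [0..<n] @ map (\<lambda>A. if \<forall>u\<in>A. y u = -1 then -1 else 1) As"
  using assms
proof (induction As rule: rev_induct)
  case (snoc A As)
  have "(map y [0..<n] @ ws) ! u = y u" if "u \<in> A" for u ws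
    using snoc.prems[of A] that by (auto simp: nth_append)
  with snoc show ?case by simp
qed simp

lemma gate_values_shift:
  assumes "topo_sorted R c" "length pre = k"
    and "\<And>r. r < R \<Longrightarrow> z r = (if \<exists>j\<in>sel r. pre ! (n + j) = -1 then -1 else 1)"
    and "\<And>r j. r < R \<Longrightarrow> j \<in> sel r \<Longrightarrow> n + j < k"
  shows "foldl (\<lambda>vs g. vs @ [gate_value y vs g]) pre (map (shift_gate n k sel) c) =
    pre @ foldl (\<lambda>vs g. vs @ [gate_value z vs g]) [] c"
  using assms(1)
proof (induction c rule: rev_induct)
  case (snoc g c)
  define ws where "ws = foldl (\<lambda>vs g. vs @ [gate_value z vs g]) [] c"
  have nth1: "(pre @ ws) ! (n + j) = pre ! (n + j)" if "r < R" "j \<in> sel r" for r j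
    using assms(2) assms(4)[OF that] by (simp add: nth_append)
  have nth2: "(pre @ ws) ! (k + j) = ws ! j" for j
    using assms(2) by (simp add: nth_append)
  have "gate_value y (pre @ ws) (shift_gate n k sel g) = gate_value z ws g"
    using snoc.prems assms(3) by (cases g) (auto simp: topo_sorted_snoc nth1 nth2)
  with snoc show ?case by (simp add: topo_sorted_snoc ws_def)
qed simp

section \<open>Depths in the substituted circuit\<close>

lemma gate_depths_inputs:
  "foldl (\<lambda>ds g. ds @ [gate_depth ds g]) [] (map Input [0..<n]) = replicate n 0"
  by (induction n) (auto simp: replicate_append_same)

lemma gate_depths_ands:
  assumes "\<And>A. A \<in> set As \<Longrightarrow> A \<subseteq> {..<n}"
  shows "foldl (\<lambda>ds g. ds @ [gate_depth ds g]) (replicate n 0) (map And_Gate As) =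
    replicate n 0 @ replicate (length As) 1"
  using assms
proof (induction As rule: rev_induct)
  case (snoc A As)
  have "(replicate n 0 @ ws) ! u = 0" if "u \<in> A" for u ws
    using snoc.prems[of A] that by (auto simp: nth_append)
  then have eq: "insert 0 ((!) (replicate n 0 @ replicate (length As) (Suc 0)) ` A) = {0}" by auto
  have "Max (insert 0 ((!) (replicate n 0 @ replicate (length As) (Suc 0)) ` A)) = 0"
    unfolding eq by simp
  with snoc show ?case by (simp add: replicate_append_same)
qed simp

text \<open>An input node has depth 0 and becomes an OR over nodes of depth at most 1, hence of
  depth at most 2; the surplus of 2 then carries over to every gate. Equality can fail, since an
  empty OR has depth 1.\<close>

lemma gate_depths_shift:
  assumes "topo_sorted R c" "length pre = k" "\<And>d. d \<in> set pre \<Longrightarrow> d \<le> 1"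
    and "\<And>r j. r < R \<Longrightarrow> j \<in> sel r \<Longrightarrow> n + j < k"
  shows "\<exists>ds'. foldl (\<lambda>ds g. ds @ [gate_depth ds g]) pre (map (shift_gate n k sel) c) = pre @ ds' \<and>
    length ds' = length c \<and>
    (\<forall>i<length c. ds' ! i \<le> foldl (\<lambda>ds g. ds @ [gate_depth ds g]) [] c ! i + 2)"
  using assms(1)
proof (induction c rule: rev_induct)
  case (snoc g c)
  define ds where "ds = foldl (\<lambda>ds g. ds @ [gate_depth ds g]) [] c"
  have len: "length ds = length c" by (simp add: ds_def)
  obtain ds' where ds': "foldl (\<lambda>ds g. ds @ [gate_depth ds g]) pre (map (shift_gate n k sel) c) = pre @ ds'"
    "length ds' = length c" "\<And>i. i < length c \<Longrightarrow> ds' ! i \<le> ds ! i + 2"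
    using snoc by (auto simp: topo_sorted_snoc ds_def)
  have nth2: "(pre @ ds') ! (k + j) = ds' ! j" for j
    using assms(2) by (simp add: nth_append)
  have max_le: "Max (insert 0 ((!) (pre @ ds') ` (+) k ` J)) \<le> Max (insert 0 ((!) ds ` J)) + 2"
    if J: "J \<subseteq> {..<length c}" for J
  proof -
    have fin: "finite J" using J finite_subset by blast
    have "(pre @ ds') ! (k + j) \<le> Max (insert 0 ((!) ds ` J)) + 2" if "j \<in> J" for j
    proof -
      have "ds ! j \<le> Max (insert 0 ((!) ds ` J))" using fin that by (intro Max_ge) auto
      then show ?thesis using ds'(3)[of j] J that by (force simp: nth2)
    qed
    with fin show ?thesis by (subst Max_le_iff) auto
  qed
  have "gate_depth (pre @ ds') (shift_gate n k sel g) \<le> gate_depth ds g + 2"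
  proof (cases g)
    case (Input r)
    then have r: "r < R" using snoc.prems by (simp add: topo_sorted_snoc)
    have "(+) n ` sel r \<subseteq> {..<k}" using assms(4)[OF r] by auto
    then have fin: "finite ((+) n ` sel r)" using finite_subset by blast
    have "(pre @ ds') ! (n + j) \<le> 1" if "j \<in> sel r" for j
      using assms(2) assms(4)[OF r that] assms(3) by (simp add: nth_append)
    then have "Max (insert 0 ((!) (pre @ ds') ` (+) n ` sel r)) \<le> 1"
      using fin by (subst Max_le_iff) auto
    with Input show ?thesis by simp
  next
    case (And_Gate J)
    with max_le[of J] snoc.prems show ?thesis by (simp add: topo_sorted_snoc)
  next
    case (Or_Gate J)
    with max_le[of J] snoc.prems show ?thesis by (simp add: topo_sorted_snoc)
  next
    case (Not_Gate j)
    with ds'(3)[of j] snoc.prems show ?thesis by (simp add: topo_sorted_snoc nth2)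
  qed
  then have "(ds' @ [gate_depth (pre @ ds') (shift_gate n k sel g)]) ! i \<le> (ds @ [gate_depth ds g]) ! i + 2"
    if "i < length (c @ [g])" for i
    using that ds'(2,3) len by (auto simp: nth_append less_Suc_eq)
  with ds'(1,2) show ?case
    by (intro exI[of _ "ds' @ [gate_depth (pre @ ds') (shift_gate n k sel g)]"]) (simp add: ds_def)
qed simp

locale circuit_substitution =
  fixes n R :: nat and As :: "nat set list" and sel :: "nat \<Rightarrow> nat set" and c :: circuit
  assumes wf: "circuit_wf R c"
    and As: "\<And>A. A \<in> set As \<Longrightarrow> A \<subseteq> {..<n}"
    and sel: "\<And>r. r < R \<Longrightarrow> sel r \<subseteq> {..<length As}"
begin

abbreviation "c' \<equiv> subst_circuit n As sel c"

lemma topo: "topo_sorted R c" and nonempty: "c \<noteq> []"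
  using wf by (auto simp: circuit_wf_alt)

lemma nth_subst_circuit:
  assumes "i < length c'"
  shows "(i < n \<and> c' ! i = Input i) \<or>
    (n \<le> i \<and> i < n + length As \<and> c' ! i = And_Gate (As ! (i - n))) \<or>
    (n + length As \<le> i \<and> i - (n + length As) < length c \<and>
       c' ! i = shift_gate n (n + length As) sel (c ! (i - (n + length As))))"
  using assms by (auto simp: subst_circuit_def nth_append)

lemma is_Input_subst: "i < length c' \<Longrightarrow> is_Input (c' ! i) \<longleftrightarrow> i < n"
proof -
  have "\<not> is_Input (shift_gate n k sel g)" for k g by (cases g) auto
  then show "i < length c' \<Longrightarrow> is_Input (c' ! i) \<longleftrightarrow> i < n"
    using nth_subst_circuit[of i] by auto
qed

text \<open>The bound from below says that no gate of the copy reads an input variable directly, the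
  bound from above that the order stays topological.\<close>

lemma gate_inputs_shift:
  assumes "i < length c"
  shows "gate_inputs (shift_gate n (n + length As) sel (c ! i)) \<subseteq> {n..<n + length As + i}"
proof -
  have "gate_inputs (c ! i) \<subseteq> {..<i}" using topo assms by (simp add: topo_sorted_def)
  moreover have "v < R" if "c ! i = Input v" for v
    using topo assms that unfolding topo_sorted_def by (metis nth_mem)
  ultimately show ?thesis using sel by (cases "c ! i") fastforce+
qed

lemma wf_subst: "circuit_wf n c'"
  unfolding circuit_wf_def
proof (intro conjI allI impI)
  show "c' \<noteq> []" using nonempty by (simp add: subst_circuit_def)
  have "Input v \<noteq> shift_gate n k sel g" for k g v by (cases g) auto
  then show "v < n" if "Input v \<in> set c'" for v using that by (auto simp: subst_circuit_def)
  fix i assume i: "i < length c'"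
  from nth_subst_circuit[OF i] show "gate_inputs (c' ! i) \<subseteq> {..<i}"
  proof (elim disjE conjE)
    assume "n \<le> i" "i < n + length As" and g: "c' ! i = And_Gate (As ! (i - n))"
    then have "As ! (i - n) \<subseteq> {..<n}" by (intro As) simp
    then have "As ! (i - n) \<subseteq> {..<i}" using \<open>n \<le> i\<close> by force
    with g show ?thesis by simp
  next
    assume j: "n + length As \<le> i" "i - (n + length As) < length c"
      and g: "c' ! i = shift_gate n (n + length As) sel (c ! (i - (n + length As)))"
    have "gate_inputs (c' ! i) \<subseteq> {n..<n + length As + (i - (n + length As))}"
      unfolding g by (rule gate_inputs_shift[OF j(2)])
    then show ?thesis using j(1) by auto
  qed simp
qed

lemma value_subst:
  assumes z: "\<And>r. r < R \<Longrightarrow> z r = (if \<exists>j\<in>sel r. \<forall>u\<in>As ! j. y u = -1 then -1 else 1)"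
  shows "circuit_value c' y = circuit_value c z"
proof -
  let ?pre = "map y [0..<n] @ map (\<lambda>A. if \<forall>u\<in>A. y u = -1 then -1 else 1) As"
  have pre: "?pre ! (n + j) = (if \<forall>u\<in>As ! j. y u = -1 then -1 else 1)" if "j < length As" for j
    using that by (simp add: nth_append)
  have "z r = (if \<exists>j\<in>sel r. ?pre ! (n + j) = -1 then -1 else 1)" if "r < R" for r
  proof -
    have "?pre ! (n + j) = -1 \<longleftrightarrow> (\<forall>u\<in>As ! j. y u = -1)" if "j \<in> sel r" for j
    proof -
      have "j < length As" using sel[OF \<open>r < R\<close>] that by blast
      from pre[OF this] show ?thesis by simp
    qed
    then show ?thesis using z[OF that] by (simp cong: bex_cong)
  qed
  then have "foldl (\<lambda>vs g. vs @ [gate_value y vs g]) ?pre (map (shift_gate n (n + length As) sel) c) =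
      ?pre @ foldl (\<lambda>vs g. vs @ [gate_value z vs g]) [] c"
    using sel by (intro gate_values_shift[OF topo]) auto
  then have "foldl (\<lambda>vs g. vs @ [gate_value y vs g]) [] c' =
      ?pre @ foldl (\<lambda>vs g. vs @ [gate_value z vs g]) [] c"
    using As by (simp add: subst_circuit_def gate_values_inputs gate_values_ands)
  moreover have "foldl (\<lambda>vs g. vs @ [gate_value z vs g]) [] c \<noteq> []"
    using nonempty by (simp flip: length_greater_0_conv)
  ultimately show ?thesis by (simp add: circuit_value_def)
qed

lemma depth_subst: "circuit_depth c' \<le> circuit_depth c + 2"
proof -
  let ?pre = "replicate n 0 @ replicate (length As) (1::nat)"
  obtain ds' where ds': "foldl (\<lambda>ds g. ds @ [gate_depth ds g]) ?pre
        (map (shift_gate n (n + length As) sel) c) = ?pre @ ds'" "length ds' = length c"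
    "\<And>i. i < length c \<Longrightarrow> ds' ! i \<le> foldl (\<lambda>ds g. ds @ [gate_depth ds g]) [] c ! i + 2"
    using gate_depths_shift[OF topo, of ?pre "n + length As" sel n] sel by fastforce
  have "foldl (\<lambda>ds g. ds @ [gate_depth ds g]) [] c' = ?pre @ ds'"
    using As ds'(1) by (simp add: subst_circuit_def gate_depths_inputs gate_depths_ands)
  moreover have "ds' \<noteq> []" using ds'(2) nonempty by auto
  ultimately have "circuit_depth c' = last ds'" by (simp add: circuit_depth_def)
  also have "\<dots> = ds' ! (length c - 1)" using \<open>ds' \<noteq> []\<close> ds'(2) by (simp add: last_conv_nth)
  also have "\<dots> \<le> foldl (\<lambda>ds g. ds @ [gate_depth ds g]) [] c ! (length c - 1) + 2"
    using nonempty by (intro ds'(3)) simp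
  also have "foldl (\<lambda>ds g. ds @ [gate_depth ds g]) [] c ! (length c - 1) = circuit_depth c"
  proof -
    have "foldl (\<lambda>ds g. ds @ [gate_depth ds g]) [] c \<noteq> []"
      using nonempty by (simp flip: length_greater_0_conv)
    then show ?thesis by (simp add: circuit_depth_def last_conv_nth)
  qed
  finally show ?thesis .
qed

lemma size_subst: "circuit_size c' = n + length As + circuit_size c"
  by (simp add: circuit_size_def subst_circuit_def)

lemma monotone_subst: "monotone_circuit c \<Longrightarrow> monotone_circuit c'"
proof -
  have "is_Not (shift_gate n k sel g) = is_Not g" for k g by (cases g) auto
  then show "monotone_circuit c \<Longrightarrow> monotone_circuit c'"
    by (auto simp: monotone_circuit_def subst_circuit_def)
qed

text \<open>The former input nodes are OR gates over \<open>As\<close>, and all gates of the copy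
  read positions from \<open>n\<close> on, so only the gates made from \<open>As\<close> can see
  variables. The output lies in the copy.\<close>

lemma AND_at_bottom_subst: "AND_at_bottom c'"
  unfolding AND_at_bottom_def
proof (intro conjI ballI impI)
  have ne: "c' \<noteq> []" using nonempty by (simp add: subst_circuit_def)
  have "length c' - 1 \<ge> n"
    using nonempty by (cases c) (auto simp: subst_circuit_def)
  then show "\<not> is_Input (last c')"
    using is_Input_subst[of "length c' - 1"] ne by (simp add: last_conv_nth)
next
  fix g assume g: "g \<in> set c'" and "\<exists>j\<in>gate_inputs g. is_Input (c' ! j)"
  then obtain i j where i: "i < length c'" "g = c' ! i" and j: "j \<in> gate_inputs g" "is_Input (c' ! j)"
    by (metis in_set_conv_nth)
  have "j < length c'" using i j wf_subst by (force simp: circuit_wf_def)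
  then have "j < n" using j(2) is_Input_subst by blast
  have "\<exists>A\<in>set As. g = And_Gate A"
    using nth_subst_circuit[OF i(1)]
  proof (elim disjE conjE)
    assume "n + length As \<le> i" "i - (n + length As) < length c"
      "c' ! i = shift_gate n (n + length As) sel (c ! (i - (n + length As)))"
    then have "j \<ge> n" using gate_inputs_shift[of "i - (n + length As)"] i(2) j(1) by auto
    with \<open>j < n\<close> show ?thesis by simp
  next
    assume "n \<le> i" "i < n + length As" "c' ! i = And_Gate (As ! (i - n))"
    then show ?thesis using i(2) by (auto intro!: bexI[of _ "As ! (i - n)"])
  qed (use i(2) j(1) in auto)
  then obtain A where A: "A \<in> set As" "g = And_Gate A" by blast
  then show "is_And g" by simp
  fix v assume "v \<in> gate_inputs g"
  then have "v < n" using A As by auto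
  moreover have "n \<le> length c'" by (simp add: subst_circuit_def)
  ultimately show "is_Input (c' ! v)" using is_Input_subst[of v] by simp
qed

end

text \<open>The distributive law: the choice function \<open>a\<close> selects one term of
  \<open>W r\<close> for each variable \<open>r\<close> of \<open>t\<close>. Its values outside
  \<open>t\<close> do not affect the union.\<close>

definition subst_dnf :: "(nat \<Rightarrow> nat set set) \<Rightarrow> mono_dnf \<Rightarrow> mono_dnf" where
  "subst_dnf W T = (\<Union>t\<in>T. (\<lambda>a. \<Union>r\<in>t. a r) ` Pi t W)"

lemma dnf_value_subst:
  assumes "\<And>t. t \<in> T \<Longrightarrow> t \<subseteq> {..<R}"
    and z: "\<And>r. r < R \<Longrightarrow> z r = (if \<exists>A\<in>W r. \<forall>u\<in>A. y u = -1 then -1 else 1)"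
  shows "dnf_value (subst_dnf W T) y = dnf_value T z"
proof -
  have "(\<exists>a\<in>Pi t W. \<forall>u\<in>(\<Union>r\<in>t. a r). y u = -1) \<longleftrightarrow> (\<forall>r\<in>t. z r = -1)" if "t \<in> T" for t
  proof -
    have "z r = -1 \<longleftrightarrow> (\<exists>A\<in>W r. \<forall>u\<in>A. y u = -1)" if "r \<in> t" for r
    proof -
      have "r < R" using assms(1)[OF \<open>t \<in> T\<close>] that by blast
      from z[OF this] show ?thesis by simp
    qed
    note z_iff = this
    show ?thesis
    proof
      assume "\<exists>a\<in>Pi t W. \<forall>u\<in>(\<Union>r\<in>t. a r). y u = -1"
      then show "\<forall>r\<in>t. z r = -1" using z_iff by blast
    next
      assume "\<forall>r\<in>t. z r = -1"
      then have "\<forall>r\<in>t. \<exists>A. A \<in> W r \<and> (\<forall>u\<in>A. y u = -1)" using z_iff by blast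
      then obtain a where "\<forall>r\<in>t. a r \<in> W r \<and> (\<forall>u\<in>a r. y u = -1)" by metis
      then show "\<exists>a\<in>Pi t W. \<forall>u\<in>(\<Union>r\<in>t. a r). y u = -1" by (intro bexI[of _ a]) auto
    qed
  qed
  then have "(\<exists>A\<in>subst_dnf W T. \<forall>u\<in>A. y u = -1) \<longleftrightarrow> (\<exists>t\<in>T. \<forall>r\<in>t. z r = -1)"
    by (auto simp: subst_dnf_def)
  then show ?thesis by (simp add: dnf_value_def)
qed

lemma subst_dnf_subset:
  assumes "\<And>t. t \<in> T \<Longrightarrow> t \<subseteq> {..<R}" "\<And>r A. r < R \<Longrightarrow> A \<in> W r \<Longrightarrow> A \<subseteq> {..<n}" "t \<in> subst_dnf W T"
  shows "t \<subseteq> {..<n}"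
proof
  fix u assume "u \<in> t"
  obtain t' a where "t' \<in> T" and a: "a \<in> Pi t' W" and t: "t = (\<Union>r\<in>t'. a r)"
    using assms(3) by (auto simp: subst_dnf_def)
  obtain r where r: "r \<in> t'" "u \<in> a r" using t \<open>u \<in> t\<close> by blast
  have "r < R" using assms(1)[OF \<open>t' \<in> T\<close>] r(1) by blast
  then have "a r \<subseteq> {..<n}" by (rule assms(2)) (rule Pi_mem[OF a r(1)])
  with r(2) show "u \<in> {..<n}" by blast
qed

lemma dnf_width_subst:
  assumes T: "\<And>t. t \<in> T \<Longrightarrow> t \<subseteq> {..<R}"
    and W: "\<And>r A. r < R \<Longrightarrow> A \<in> W r \<Longrightarrow> A \<subseteq> {..<n} \<and> card A \<le> M"
  shows "dnf_width (subst_dnf W T) \<le> dnf_width T * M"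
proof -
  have finT: "finite T" by (rule finite_subset[of _ "Pow {..<R}"]) (use T in auto)
  have "card (\<Union>r\<in>t. a r) \<le> dnf_width T * M" if t: "t \<in> T" "a \<in> Pi t W" for t a
  proof -
    have fin: "finite t" using T[OF t(1)] finite_subset by blast
    have "card (\<Union>r\<in>t. a r) \<le> (\<Sum>r\<in>t. card (a r))" by (rule card_UN_le[OF fin])
    also have "\<dots> \<le> (\<Sum>r\<in>t. M)" using W T[OF t(1)] t(2) by (intro sum_mono) (auto simp: Pi_iff)
    also have "\<dots> = card t * M" by simp
    also have "\<dots> \<le> dnf_width T * M"
      unfolding dnf_width_def using finT t(1) by (intro mult_le_mono1 Max_ge) auto
    finally show ?thesis .
  qed
  then have bound: "card A \<le> dnf_width T * M" if "A \<in> subst_dnf W T" for A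
    using that by (auto simp: subst_dnf_def)
  have "finite (subst_dnf W T)"
    by (rule finite_subset[of _ "Pow {..<n}"]) (use subst_dnf_subset[OF T, where n = n and W = W] W in auto)
  with bound show ?thesis unfolding dnf_width_def[of "subst_dnf W T"] by (subst Max_le_iff) auto
qed

section \<open>The main construction\<close>

text \<open>\<open>R > 0\<close> makes the logarithm at least 1, so rounding up at most doubles it.
  The bound \<open>R + 1 \<le> 2 ^ l\<close> provides for \<open>R\<close> symbols and the
  padding.\<close>

lemma ceiling_log_bounds:
  fixes R :: nat
  assumes "R > 0"
  defines "l \<equiv> nat \<lceil>log 2 (real (R + 1))\<rceil>"
  shows "0 < l" "R + 1 \<le> 2 ^ l" "2 ^ l \<le> 2 * (R + 1)" "real l \<le> 2 * log 2 (real (R + 1))"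
proof -
  let ?L = "log 2 (real (R + 1))"
  have L1: "1 \<le> ?L" using assms(1) by (subst le_log_iff) auto
  have ceil: "real l = of_int \<lceil>?L\<rceil>"
    unfolding l_def using L1 by (intro of_nat_nat) linarith
  have lower: "?L \<le> real l" and upper: "real l \<le> ?L + 1"
    unfolding ceil by linarith+
  have "0 < real l" using L1 lower by linarith
  then show "0 < l" by simp
  have powr: "2 powr ?L = real (R + 1)" by simp
  have "2 powr ?L \<le> 2 powr real l" using lower by (intro powr_mono) auto
  then have "real (R + 1) \<le> real (2 ^ l)" unfolding powr by (simp add: powr_realpow)
  then show "R + 1 \<le> 2 ^ l" by (simp only: of_nat_le_iff)
  have "2 powr real l \<le> 2 powr (?L + 1)" using upper by (intro powr_mono) auto
  also have "\<dots> = real (2 * (R + 1))" unfolding powr_add powr by simp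
  finally have "real (2 ^ l) \<le> real (2 * (R + 1))" by (simp add: powr_realpow)
  then show "2 ^ l \<le> 2 * (R + 1)" by (simp only: of_nat_le_iff)
  show "real l \<le> 2 * ?L" using upper L1 by linarith
qed

text \<open>Since \<open>2 ^ l\<close> is at most linear in \<open>R\<close>, even one AND gate for
  each pair of a block and a word is affordable. With \<open>X = s + N + R\<close>,
  \<open>12 \<le> X ^ 3\<close> and \<open>2 ^ l \<le> X ^ 2\<close>, each summand is at most
  \<open>X ^ 13\<close>, and \<open>3 \<le> X\<close>.\<close>

lemma circuit_size_bound:
  fixes N R l s :: nat
  assumes "0 < N" "0 < R" "0 < s" "2 ^ l \<le> 2 * (R + 1)"
  shows "12 * N * l + N * 2 ^ (6 * l) + s \<le> (s + N + R) ^ 14"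
proof -
  define X where "X = s + N + R"
  have X: "3 \<le> X" "N \<le> X" "s \<le> X" "R + 1 \<le> X" using assms by (auto simp: X_def)
  have pow: "2 ^ l \<le> X ^ 2"
  proof -
    have "2 ^ l \<le> 2 * X" using assms(4) mult_le_mono2[OF X(4), of 2] by (rule order_trans)
    also have "\<dots> \<le> X ^ 2" using X(1) by (simp add: power2_eq_square)
    finally show ?thesis .
  qed
  have mono: "X ^ i \<le> X ^ j" if "i \<le> j" for i j using X(1) that by (intro power_increasing) auto
  have "12 \<le> X ^ 3" using power_mono[OF X(1), of 3] by simp
  moreover have "l \<le> X ^ 2" using less_exp[of l] pow by (meson less_imp_le order_trans)
  ultimately have "12 * N * l \<le> X ^ 3 * X * X ^ 2" using X(2) by (intro mult_le_mono)
  also have "\<dots> = X ^ 6" by (simp add: eval_nat_numeral)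
  also have "\<dots> \<le> X ^ 13" by (rule mono) simp
  finally have 1: "12 * N * l \<le> X ^ 13" .
  have "N * 2 ^ (6 * l) = N * (2 ^ l) ^ 6"
    unfolding power_mult[symmetric] by (simp add: mult.commute)
  also have "\<dots> \<le> X * (X ^ 2) ^ 6"
    using X(2) pow by (intro mult_le_mono power_mono) auto
  also have "\<dots> = X ^ (1 + 2 * 6)" unfolding power_add power_mult by simp
  also have "\<dots> = X ^ 13" by simp
  finally have 2: "N * 2 ^ (6 * l) \<le> X ^ 13" .
  have 3: "s \<le> X ^ 13" using X(3) mono[of 1 13] by simp
  have "12 * N * l + N * 2 ^ (6 * l) + s \<le> 3 * X ^ 13" using 1 2 3 by linarith
  also have "\<dots> \<le> X * X ^ 13" using X(1) by (intro mult_le_mono1)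
  also have "\<dots> = X ^ 14" unfolding power_Suc[symmetric] by simp
  finally show ?thesis by (simp add: X_def)
qed

theorem theorem3p2:
  "\<exists>(C::real) (a::nat). \<forall>(N::nat) (R::nat) (F::(nat \<Rightarrow> real) \<Rightarrow> real).
     N > 0 \<longrightarrow> R > 0 \<longrightarrow> F \<in> cube R \<rightarrow> {-1, 1} \<longrightarrow>
     (let l = nat \<lceil>log 2 (real (R + 1))\<rceil>; n = 12 * N * l in
      \<exists>g::(nat \<Rightarrow> real) \<Rightarrow> real. g \<in> cube n \<rightarrow> {-1, 1} \<and>
        (\<forall>\<epsilon>>0. approx_deg n (cube n) \<epsilon> g
                 \<ge> approx_deg (N * R) (cube_le (N * R) N) \<epsilon> (compose_OR F R N) * l) \<and>
        (\<forall>k s. (\<exists>c. circuit_computes R c F \<and> circuit_depth c \<le> k \<and> circuit_size c \<le> s) \<longrightarrow>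
           (\<exists>c. circuit_computes n c g \<and> circuit_depth c \<le> k + 2 \<and>
                circuit_size c \<le> (s + N + R) ^ a)) \<and>
        (\<forall>k s. (\<exists>c. circuit_computes R c F \<and> monotone_circuit c \<and>
                    circuit_depth c \<le> k \<and> circuit_size c \<le> s) \<longrightarrow>
           (\<exists>c. circuit_computes n c g \<and> monotone_circuit c \<and> AND_at_bottom c \<and>
                circuit_depth c \<le> k + 2 \<and> circuit_size c \<le> (s + N + R) ^ a)) \<and>
        (\<forall>w. (\<exists>T. dnf_computes R T F \<and> dnf_width T \<le> w) \<longrightarrow>
           (\<exists>T. dnf_computes n T g \<and>
                real (dnf_width T) \<le> C * real w * log 2 (real (R + 1)))))"
\<comment> \<open>24 is 12, from the \<open>12 * l\<close> entries of a block, times 2 for rounding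
  the logarithm up; 14 is the exponent in \<open>circuit_size_bound\<close>.\<close>
proof (intro exI[of _ "24::real"] exI[of _ "14::nat"] allI impI)
  fix N R :: nat and F :: "(nat \<Rightarrow> real) \<Rightarrow> real"
  assume N: "N > 0" and R: "R > 0" and F: "F \<in> cube R \<rightarrow> {-1, 1}"
  define l where "l = nat \<lceil>log 2 (real (R + 1))\<rceil>"
  define n where "n = 12 * N * l"
  note l = ceiling_log_bounds[OF R, folded l_def]
  let ?B = "Pow {..<6 * l}"
  obtain \<mu> :: "nat \<Rightarrow> nat set \<Rightarrow> real" where \<mu>:
    "\<forall>r b. \<mu> r b \<ge> 0"
    "\<forall>r. (\<Sum>b\<in>?B. \<mu> r b) = 1"
    "\<forall>r<R + 1. \<forall>r'<R + 1. \<forall>b. \<mu> r b \<noteq> 0 \<longrightarrow> \<mu> r' b \<noteq> 0 \<longrightarrow> r = r'"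
    "\<forall>r r' S. S \<subseteq> {..<6 * l} \<longrightarrow> card S < l \<longrightarrow>
       (\<Sum>b\<in>?B. \<mu> r b * chi S b) = (\<Sum>b\<in>?B. \<mu> r' b * chi S b)"
    using indistinguishable_distributions[OF l(2,1)] by (elim exE conjE) (rule that)
  note nonneg = \<mu>(1)[rule_format] and total = \<mu>(2)[rule_format]
    and disj = \<mu>(3)[rule_format] and moment = \<mu>(4)[rule_format]
  define code where "code i b = (\<lambda>v. i * (12 * l) + v) ` encode l b" for i b
  \<comment> \<open>A term of \<open>W r\<close> recognises, in one block, a word in the support of
    the symbol \<open>r + 1\<close>. Symbol 0 gets no terms, being padding.\<close>
  define W where "W r = {code i b | i b. i < N \<and> b \<in> ?B \<and> \<mu> (Suc r) b \<noteq> 0}" for r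
  define z where "z y = restrict (\<lambda>r. if \<exists>A\<in>W r. \<forall>u\<in>A. y u = -1 then -1 else 1 :: real) {..<R}"
    for y :: "nat \<Rightarrow> real"
  define g where "g y = F (z y)" for y
  have z_cube: "z y \<in> cube R" for y by (auto simp: z_def cube_def)
  have z: "z y r = (if \<exists>A\<in>W r. \<forall>u\<in>A. y u = -1 then -1 else 1)" if "r < R" for y r
    using that by (simp add: z_def)
  have code: "code i b \<subseteq> {..<n}" "card (code i b) \<le> 12 * l" if "i < N" for i b
  proof -
    show "code i b \<subseteq> {..<n}"
      using block_index_less[OF that] by (auto simp: code_def encode_def n_def)
    have "card (code i b) \<le> card (encode l b)"
      unfolding code_def by (rule card_image_le) (simp add: encode_def)
    then show "card (code i b) \<le> 12 * l" using card_encode_le[of l b] by linarith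
  qed
  have g_range: "g \<in> cube n \<rightarrow> {-1, 1}" using F z_cube by (auto simp: g_def)
  have degree: "approx_deg (N * R) (cube_le (N * R) N) \<epsilon> (compose_OR F R N) * l
      \<le> approx_deg n (cube n) \<epsilon> g" if "\<epsilon> > 0" for \<epsilon>
  proof -
    obtain s :: "(nat \<Rightarrow> real) \<Rightarrow> nat \<Rightarrow> nat" where s:
      "\<forall>\<psi>. poly_on (N * R) 1 (cube_le (N * R) N) (\<lambda>x. \<Sum>j<N. \<psi> (s x j))"
      "\<forall>x j. s x j \<le> R"
      "\<forall>x\<in>cube_le (N * R) N. \<forall>r<R.
         (\<exists>j<N. s x j = Suc r) \<longleftrightarrow> (\<exists>j<N. x (r * N + j) = -1)"
      using symbols_of_input[of N R] by (elim exE conjE) (rule that)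
    note lin = s(1)[rule_format] and s_le = s(2)[rule_format] and s_iff = s(3)[rule_format]
    have agree: "g (encode_vector N l \<beta>) = compose_OR F R N x"
      if x: "x \<in> cube_le (N * R) N" and \<pi>: "\<pi> permutes {..<N}"
        and \<beta>: "\<And>i. i < N \<Longrightarrow> \<beta> i \<subseteq> {..<6 * l}" "\<And>i. i < N \<Longrightarrow> \<mu> (s x (\<pi> i)) (\<beta> i) \<noteq> 0"
      for x \<pi> \<beta>
    proof -
      let ?y = "encode_vector N l \<beta>"
      have hit: "(\<exists>A\<in>W r. \<forall>u\<in>A. ?y u = -1) \<longleftrightarrow> (\<exists>j<N. x (r * N + j) = -1)" if r: "r < R" for r
      proof -
        have "(\<exists>A\<in>W r. \<forall>u\<in>A. ?y u = -1) \<longleftrightarrow>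
          (\<exists>i<N. \<exists>b\<in>?B. \<mu> (Suc r) b \<noteq> 0 \<and> (\<forall>v\<in>encode l b. ?y (i * (12 * l) + v) = -1))"
          unfolding W_def code_def by blast
        also have "\<dots> \<longleftrightarrow> (\<exists>i<N. \<exists>b\<in>?B. \<mu> (Suc r) b \<noteq> 0 \<and> \<beta> i = b)"
          using encode_vector_dominates \<beta>(1) by (metis PowD)
        also have "\<dots> \<longleftrightarrow> (\<exists>i<N. \<mu> (Suc r) (\<beta> i) \<noteq> 0)"
          using \<beta>(1) by blast
        \<comment> \<open>The supports for the symbols from 0 to \<open>R\<close> are disjoint, so
          the word in block \<open>i\<close> reveals its symbol.\<close>
        also have "\<dots> \<longleftrightarrow> (\<exists>i<N. s x (\<pi> i) = Suc r)"
        proof -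
          have "\<mu> (Suc r) (\<beta> i) \<noteq> 0 \<longleftrightarrow> s x (\<pi> i) = Suc r" if "i < N" for i
          proof -
            have "s x (\<pi> i) < R + 1" using s_le by (simp add: less_Suc_eq_le)
            with disj[of "s x (\<pi> i)" "Suc r" "\<beta> i"] \<beta>(2)[OF that] r show ?thesis by auto
          qed
          then show ?thesis by blast
        qed
        \<comment> \<open>A permutation does not alter the set of symbols that occur.\<close>
        also have "\<dots> \<longleftrightarrow> (\<exists>j<N. s x j = Suc r)"
        proof -
          have "\<pi> ` {..<N} = {..<N}" by (rule permutes_image[OF \<pi>])
          then show ?thesis by (metis (no_types, lifting) imageE imageI lessThan_iff)
        qed
        also have "\<dots> \<longleftrightarrow> (\<exists>j<N. x (r * N + j) = -1)" by (rule s_iff[OF x r])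
        finally show ?thesis .
      qed
      have "z ?y = restrict (\<lambda>i. OR_fun N (restrict (\<lambda>j. x (i * N + j)) {..<N})) {..<R}"
        by (rule ext) (simp add: z_def hit OR_fun_def cong: conj_cong)
      then show ?thesis by (simp add: g_def compose_OR_def)
    qed
    show ?thesis unfolding n_def
    proof (rule approx_deg_block_encoding[where \<mu> = \<mu> and s = s])
      show "g (encode_vector N l \<beta>) = compose_OR F R N x"
        if "x \<in> cube_le (N * R) N" "\<pi> permutes {..<N}" "\<And>i. i < N \<Longrightarrow> \<beta> i \<subseteq> {..<6 * l}"
          "\<And>i. i < N \<Longrightarrow> \<mu> (s x (\<pi> i)) (\<beta> i) \<noteq> 0" for x \<pi> \<beta>
        using that by (rule agree)
    qed (use \<open>\<epsilon> > 0\<close> l(1) nonneg total moment lin in auto)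
  qed
  \<comment> \<open>All pairs of a block and a word are listed, whether or not they belong to some
    \<open>W r\<close>; this fixes the number of AND gates.\<close>
  obtain xs where xs: "set xs = {..<N} \<times> ?B" "distinct xs"
    using finite_distinct_list[of "{..<N} \<times> ?B"] by auto
  have len_xs: "length xs = N * 2 ^ (6 * l)"
    using distinct_card[OF xs(2)] by (simp add: xs(1) card_cartesian_product card_Pow)
  define As where "As = map (\<lambda>(i, b). code i b) xs"
  \<comment> \<open>Only the word is tested, as a symbol counts in whichever block it
    occurs.\<close>
  define sel where "sel r = {j \<in> {..<length xs}. \<mu> (Suc r) (snd (xs ! j)) \<noteq> 0}" for r
  have W_eq: "(\<lambda>j. As ! j) ` sel r = W r" for r
  proof (intro set_eqI iffI)
    fix A assume "A \<in> (\<lambda>j. As ! j) ` sel r"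
    then obtain j where j: "j < length xs" "\<mu> (Suc r) (snd (xs ! j)) \<noteq> 0" "A = As ! j"
      by (auto simp: sel_def)
    obtain i b where ib: "xs ! j = (i, b)" by fastforce
    then have "i < N" "b \<in> ?B" using nth_mem[OF j(1)] xs(1) by auto
    then show "A \<in> W r" using j ib by (auto simp: W_def As_def)
  next
    fix A assume "A \<in> W r"
    then obtain i b where ib: "i < N" "b \<in> ?B" "\<mu> (Suc r) b \<noteq> 0" "A = code i b"
      by (auto simp: W_def)
    then have "(i, b) \<in> set xs" using xs(1) by auto
    then obtain j where "j < length xs" "xs ! j = (i, b)" by (metis in_set_conv_nth)
    with ib show "A \<in> (\<lambda>j. As ! j) ` sel r"
      by (intro image_eqI[of _ _ j]) (auto simp: As_def sel_def)
  qed
  have subst: "circuit_substitution n R As sel c" if "circuit_wf R c" for c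
  proof
    show "circuit_wf R c" by (rule that)
    show "A \<subseteq> {..<n}" if "A \<in> set As" for A
      using that code(1) xs(1) by (auto simp: As_def)
    show "sel r \<subseteq> {..<length As}" for r by (auto simp: sel_def As_def)
  qed
  have circuit: "circuit_computes n (subst_circuit n As sel c) g \<and>
      circuit_depth (subst_circuit n As sel c) \<le> k + 2 \<and>
      circuit_size (subst_circuit n As sel c) \<le> (s + N + R) ^ 14 \<and>
      AND_at_bottom (subst_circuit n As sel c) \<and>
      (monotone_circuit c \<longrightarrow> monotone_circuit (subst_circuit n As sel c))"
    if c: "circuit_computes R c F" "circuit_depth c \<le> k" "circuit_size c \<le> s" for c k s
  proof -
    interpret circuit_substitution n R As sel c
      using c(1) by (intro subst) (simp add: circuit_computes_def)
    have "circuit_value c' y = g y" for y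
    proof -
      have "z y r = (if \<exists>j\<in>sel r. \<forall>u\<in>As ! j. y u = -1 then -1 else 1)" if "r < R" for r
        unfolding z[OF that] W_eq[of r, symmetric] by simp
      then have "circuit_value c' y = circuit_value c (z y)" by (rule value_subst)
      also have "\<dots> = g y" using c(1) z_cube by (simp add: circuit_computes_def g_def)
      finally show ?thesis .
    qed
    then have "circuit_computes n c' g" using wf_subst by (simp add: circuit_computes_def)
    moreover have "circuit_depth c' \<le> k + 2" using depth_subst c(2) by linarith
    moreover have "circuit_size c' \<le> (s + N + R) ^ 14"
    proof -
      have "0 < s" using nonempty c(3) by (cases c) (auto simp: circuit_size_def)
      have "circuit_size c' \<le> 12 * N * l + N * 2 ^ (6 * l) + s"
        using size_subst c(3) len_xs by (simp add: As_def n_def)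
      also have "\<dots> \<le> (s + N + R) ^ 14"
        by (rule circuit_size_bound[OF N R \<open>0 < s\<close> l(3)])
      finally show ?thesis .
    qed
    ultimately show ?thesis using AND_at_bottom_subst monotone_subst by blast
  qed
  have dnf: "\<exists>T. dnf_computes n T g \<and> real (dnf_width T) \<le> 24 * real w * log 2 (real (R + 1))"
    if T: "dnf_computes R T F" "dnf_width T \<le> w" for T w
  proof (intro exI conjI)
    have TR: "t \<subseteq> {..<R}" if "t \<in> T" for t using T(1) that by (simp add: dnf_computes_def)
    have W: "A \<subseteq> {..<n} \<and> card A \<le> 12 * l" if "A \<in> W r" for A r
      using that code by (auto simp: W_def)
    have "dnf_value (subst_dnf W T) y = g y" for y
      using dnf_value_subst[OF TR, where W = W and z = "z y" and y = y] z T(1) z_cube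
      by (simp add: dnf_computes_def g_def)
    moreover have "t \<subseteq> {..<n}" if "t \<in> subst_dnf W T" for t
      by (rule subst_dnf_subset[OF TR _ that]) (use W in auto)
    ultimately show "dnf_computes n (subst_dnf W T) g" by (simp add: dnf_computes_def)
    have "dnf_width (subst_dnf W T) \<le> dnf_width T * (12 * l)"
      by (rule dnf_width_subst[OF TR]) (use W in auto)
    also have "\<dots> \<le> w * (12 * l)" using T(2) by (rule mult_le_mono1)
    finally have "real (dnf_width (subst_dnf W T)) \<le> real (w * (12 * l))" by (simp only: of_nat_le_iff)
    also have "\<dots> = 12 * real w * real l" by simp
    also have "\<dots> \<le> 12 * real w * (2 * log 2 (real (R + 1)))"
      using l(4) by (intro mult_left_mono) auto
    finally show "real (dnf_width (subst_dnf W T)) \<le> 24 * real w * log 2 (real (R + 1))" by simp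
  qed
  show "let l = nat \<lceil>log 2 (real (R + 1))\<rceil>; n = 12 * N * l in
      \<exists>g::(nat \<Rightarrow> real) \<Rightarrow> real. g \<in> cube n \<rightarrow> {-1, 1} \<and>
        (\<forall>\<epsilon>>0. approx_deg n (cube n) \<epsilon> g
                 \<ge> approx_deg (N * R) (cube_le (N * R) N) \<epsilon> (compose_OR F R N) * l) \<and>
        (\<forall>k s. (\<exists>c. circuit_computes R c F \<and> circuit_depth c \<le> k \<and> circuit_size c \<le> s) \<longrightarrow>
           (\<exists>c. circuit_computes n c g \<and> circuit_depth c \<le> k + 2 \<and>
                circuit_size c \<le> (s + N + R) ^ 14)) \<and>
        (\<forall>k s. (\<exists>c. circuit_computes R c F \<and> monotone_circuit c \<and>
                    circuit_depth c \<le> k \<and> circuit_size c \<le> s) \<longrightarrow>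
           (\<exists>c. circuit_computes n c g \<and> monotone_circuit c \<and> AND_at_bottom c \<and>
                circuit_depth c \<le> k + 2 \<and> circuit_size c \<le> (s + N + R) ^ 14)) \<and>
        (\<forall>w. (\<exists>T. dnf_computes R T F \<and> dnf_width T \<le> w) \<longrightarrow>
           (\<exists>T. dnf_computes n T g \<and>
                real (dnf_width T) \<le> 24 * real w * log 2 (real (R + 1))))"
    unfolding Let_def l_def[symmetric] n_def[symmetric]
  proof (intro exI[of _ g] conjI allI impI g_range)
    fix \<epsilon> :: real assume "\<epsilon> > 0"
    then show "approx_deg (N * R) (cube_le (N * R) N) \<epsilon> (compose_OR F R N) * l \<le> approx_deg n (cube n) \<epsilon> g"
      by (rule degree)
  qed (use circuit dnf in blast)+
qed

end
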